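(* Suppose there are constants $C_1,C_2,C_3,C_4>0$ and $t_1,t_2,t_3,t_4\ge0$ such that, for all sufficiently small $h>0$, $$C_1h^{t_1}\exp\big[-C_2(1/h)^{t_2}(\log(1/h))^{t_3}\big]\le\phi(\mathbf{x},h)\le C_3h^{t_4}\exp\big[-C_4(1/h)^{t_2}(\log(1/h))^{t_3}\big],$$ and that either $t_2>0$, or $t_3>1$ and $C_2=C_4$. Let $m(h)=C_2(1/h)^{t_2}(\log(1/h))^{t_3}$ for $0<h<1$. Assume: (1) there are constants $0<l\le L$ with $l\le K(u)\le L$ for $0\le u\le1$, and $K(u)=0$ for $u>1$; (2) for some $\beta>0$, $b_F>0$, $\|F(\mathbf{z})-F(\mathbf{x})\|\le b_F\,d(\mathbf{x},\mathbf{z})^\beta$ for all $\mathbf{z}$ in a neighborhood of $\mathbf{x}$; (3) for some $\nu>2$, $\mathbb{E}\big[\|G(\mathbf{Y})-\mathbb{E}[G(\mathbf{Y})\mid\mathbf{X}=\mathbf{z}]\|^\nu\mid\mathbf{X}=\mathbf{z}\big]$ is uniformly bounded for $\mathbf{z}$ in a neighborhood of $\mathbf{x}$; (4) for every bandwidth sequence with $h_n\to0$ and $n\phi(\mathbf{x},h_n)\to\infty$, $\widehat{\Theta}_n(\mathbf{x})-\Theta(\mathbf{x})=B_n(\mathbf{x})+V_n(\mathbf{x})+R_n(\mathbf{x})$ with $R_n(\mathbf{x})=o_{\mathbb{P}}(\delta_n)$, $\delta_n=\max\{h_n^\beta,[n\phi(\mathbf{x},h_n)]^{-1/2}\}$;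 (5) $\Theta(\cdot)$, with its corresponding $\mathbb{L}_{\mathbf{x}}$ and $F$, is such that there is a constant $b_1>0$ such that for any bandwidth sequence with $h_n\to0$ and $n\phi(\mathbf{x},h_n)\to\infty$ one has $h_n^{-\beta}\|\tilde{B}_n(\mathbf{x})\|>b_1$ for all sufficiently large $n$. Let $\{h_n\}$ be the optimum bandwidth sequence, i.e. (for all large $n$) $h_n$ minimizes over $h\in(0,1)$ the function $$f_{n}(h)=a\,h^{2\beta}+\frac{b}{nC_1}\Big(\frac1h\Big)^{t_1}\exp[m(h)],$$ where $a,b>0$ are constants. Then, with $B_n$ and $V_n$ computed with this bandwidth, $\|V_n(\mathbf{x})\|/\|B_n(\mathbf{x})\|=o_{\mathbb{P}}(1)$ as $n\to\infty$.
   Context: $(\mathcal{C},d)$ is a complete separable metric space, $\mathcal{R}$ is a measurable space, $(\mathbf{X},\mathbf{Y})$ is a random element of $\mathcal{C}\times\mathcal{R}$, and $(\mathbf{X}_i,\mathbf{Y}_i)$, $i\ge1$, are i.i.d. copies. A regular conditional distribution of $\mathbf{Y}$ given $\mathbf{X}=\mathbf{z}$ is fixed and $\mathbb{E}[\,\cdot\mid\mathbf{X}=\mathbf{z}]$ is taken with respect to it; Banach-space-valued expectations are in the Bochner sense. $\mathbf{x}\in\mathcal{C}$ is fixed and $\phi(\mathbf{x},h)=\mathbb{P}[d(\mathbf{x},\mathbf{X})\le h]$. $K:[0,\infty)\to[0,\infty)$ is a measurable kernel; bandwidths are positive and deterministic. $\mathcal{B}$ is a separable Banach space of type 2 with a Schauder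 basis (type 2: there is $c_0>0$ with $\mathbb{E}\|\sum_{i\le n}\mathbf{Z}_i\|^2\le c_0\sum_{i\le n}\mathbb{E}\|\mathbf{Z}_i\|^2$ for all $n$ and all independent zero-mean $\mathbf{Z}_i$ with finite second moments), $\mathcal{G}$ is a separable Banach space, $F:\mathcal{C}\to\mathcal{G}$ and $G:\mathcal{R}\to\mathcal{G}$ are measurable, $\mathbb{L}_{\mathbf{x}}:\mathcal{G}\to\mathcal{B}$ is continuous linear. The parameter $\Theta(\mathbf{x})\in\mathcal{B}$ is a functional of the conditional distribution of $\mathbf{Y}$ given $\mathbf{X}=\mathbf{x}$, and $\widehat{\Theta}_n(\mathbf{x})$ is the same functional of the weighted empirical measure putting mass $K(h_n^{-1}d(\mathbf{x},\mathbf{X}_i))/\sum_jK(h_n^{-1}d(\mathbf{x},\mathbf{X}_j))$ at $\mathbf{Y}_i$. Here $$B_n(\mathbf{x})=\mathbb{L}_{\mathbf{x}}\left(\frac{\sum_{i=1}^{n}F(\mathbf{X}_i)K(h_n^{-1}d(\mathbf{x},\mathbf{X}_i))}{\sum_{i=1}^{n}K(h_n^{-1}d(\mathbf{x},\mathbf{X}_i))}-F(\mathbf{x})\right),$$ $$V_n(\mathbf{x})=\mathbb{L}_{\mathbf{x}}\left(\frac{\sum_{i=1}^{n}\big[G(\mathbf{Y}_i)-\mathbb{E}[G(\mathbf{Y}_i)\mid\mathbf{X}_i]\big]K(h_n^{-1}d(\mathbf{x},\mathbf{X}_i))}{\sum_{i=1}^{n}K(h_n^{-1}d(\mathbf{x},\mathbf{X}_i))}\right),$$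 $$\tilde{B}_n(\mathbf{x})=\mathbb{L}_{\mathbf{x}}\left(\mathbb{E}\left[(F(\mathbf{X})-F(\mathbf{x}))\frac{K(h_n^{-1}d(\mathbf{x},\mathbf{X}))}{\mathbb{E}[K(h_n^{-1}d(\mathbf{x},\mathbf{X}))]}\right]\right),$$ and kernel quotients with zero denominator are read as $0$. The constants $a,b>0$ in $f_n$ are chosen so that $\mathbb{E}\|B_n(\mathbf{x})+V_n(\mathbf{x})\|^2\le f_n(h_n)$ for all sufficiently large $n$, whenever $h_n\to0$ and $n\phi(\mathbf{x},h_n)\to\infty$. A minimizer of $f_n$ over $(0,1)$ exists for all large $n$, and the resulting sequence satisfies $h_n\to0$ and $n\phi(\mathbf{x},h_n)\to\infty$. *)

theory Defs
  imports "HOL-Probability.Probability"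
begin

text \<open>In a finite-dimensional space a basis is finite and in an infinite-dimensional one it is
  a sequence; \<open>I\<close> is the set of indices that are used.\<close>
definition has_schauder_basis :: "'b::real_normed_vector itself \<Rightarrow> bool" where
  "has_schauder_basis _ \<longleftrightarrow>
     (\<exists>(e :: nat \<Rightarrow> 'b) (I :: nat set). \<forall>x. \<exists>!c :: nat \<Rightarrow> real.
        (\<forall>i. i \<notin> I \<longrightarrow> c i = 0) \<and> (\<lambda>i. c i *\<^sub>R e i) sums x)"

text \<open>Type 2. The property only involves the joint law of \<open>Z\<^sub>1, \<dots>, Z\<^sub>n\<close>, which can be
  realised on the sequence space over \<open>'b\<close>; ranging over all probability measures on
  \<open>nat \<Rightarrow> 'b\<close> is therefore the same as ranging over all probability spaces, which HOL
  cannot do inside a formula.\<close>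
definition type_two :: "'b::{banach, second_countable_topology} itself \<Rightarrow> bool" where
  "type_two _ \<longleftrightarrow>
     (\<exists>c\<^sub>0 > 0. \<forall>(P :: (nat \<Rightarrow> 'b) measure) (Z :: nat \<Rightarrow> (nat \<Rightarrow> 'b) \<Rightarrow> 'b) (n :: nat).
        prob_space P \<longrightarrow>
        prob_space.indep_vars P (\<lambda>_. borel) Z {1..n} \<longrightarrow>
        (\<forall>i\<in>{1..n}. integrable P (\<lambda>\<omega>. (norm (Z i \<omega>))\<^sup>2) \<and> integral\<^sup>L P (Z i) = 0) \<longrightarrow>
        integral\<^sup>L P (\<lambda>\<omega>. (norm (\<Sum>i=1..n. Z i \<omega>))\<^sup>2)
          \<le> c\<^sub>0 * (\<Sum>i=1..n. integral\<^sup>L P (\<lambda>\<omega>. (norm (Z i \<omega>))\<^sup>2)))"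

definition regular_cond_dist ::
  "'w measure \<Rightarrow> 'r measure \<Rightarrow> ('w \<Rightarrow> 'c::polish_space) \<Rightarrow> ('w \<Rightarrow> 'r) \<Rightarrow> ('c \<Rightarrow> 'r measure) \<Rightarrow> bool" where
  "regular_cond_dist M R X Y \<kappa> \<longleftrightarrow>
     \<kappa> \<in> borel \<rightarrow>\<^sub>M prob_algebra R \<and>
     (\<forall>A\<in>sets borel. \<forall>B\<in>sets R.
        emeasure M {\<omega> \<in> space M. X \<omega> \<in> A \<and> Y \<omega> \<in> B}
          = (\<integral>\<^sup>+\<omega>. indicator A (X \<omega>) * emeasure (\<kappa> (X \<omega>)) B \<partial>M))"

text \<open>\<open>Z\<^sub>n = o\<^sub>P(\<delta>\<^sub>n)\<close> for \<open>[0, \<infinity>]\<close>-valued \<open>Z\<^sub>n\<close>. The value \<open>\<infinity>\<close> is admitted so that a quotient with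
  vanishing denominator counts as large. Measurability is required because \<open>measure\<close>
  is 0 outside the sigma-algebra.\<close>
definition small_o_prob :: "'w measure \<Rightarrow> (nat \<Rightarrow> 'w \<Rightarrow> ennreal) \<Rightarrow> (nat \<Rightarrow> real) \<Rightarrow> bool" where
  "small_o_prob M Z \<delta> \<longleftrightarrow>
     (\<forall>n. Z n \<in> borel_measurable M) \<and>
     (\<forall>\<epsilon>>0. (\<lambda>n. measure M {\<omega> \<in> space M. Z n \<omega> > ennreal (\<epsilon> * \<delta> n)}) \<longlonglongrightarrow> 0)"

definition small_ball :: "'w measure \<Rightarrow> ('w \<Rightarrow> 'c::metric_space) \<Rightarrow> 'c \<Rightarrow> real \<Rightarrow> real" where
  "small_ball M X x h = measure M {\<omega> \<in> space M. dist x (X \<omega>) \<le> h}"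

definition bandwidth_seq ::
  "'w measure \<Rightarrow> ('w \<Rightarrow> 'c::metric_space) \<Rightarrow> 'c \<Rightarrow> (nat \<Rightarrow> real) \<Rightarrow> bool" where
  "bandwidth_seq M X x h \<longleftrightarrow>
     (\<forall>n. h n > 0) \<and> h \<longlonglongrightarrow> 0 \<and>
     filterlim (\<lambda>n. real n * small_ball M X x (h n)) at_top sequentially"

definition kernel_weight ::
  "(real \<Rightarrow> real) \<Rightarrow> 'c::metric_space \<Rightarrow> (nat \<Rightarrow> 'w \<Rightarrow> 'c) \<Rightarrow> nat \<Rightarrow> real \<Rightarrow> 'w \<Rightarrow> nat \<Rightarrow> real" where
  "kernel_weight K x Xs n h \<omega> i =
     K (dist x (Xs i \<omega>) / h) / (\<Sum>j=1..n. K (dist x (Xs j \<omega>) / h))"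

text \<open>The measure on \<open>R\<close> with mass \<open>kernel_weight \<dots> i\<close> at \<open>Ys i \<omega>\<close>, for \<open>i = 1, \<dots>, n\<close>.\<close>
definition weighted_empirical ::
  "'r measure \<Rightarrow> (real \<Rightarrow> real) \<Rightarrow> 'c::metric_space \<Rightarrow> (nat \<Rightarrow> 'w \<Rightarrow> 'c) \<Rightarrow> (nat \<Rightarrow> 'w \<Rightarrow> 'r)
     \<Rightarrow> nat \<Rightarrow> real \<Rightarrow> 'w \<Rightarrow> 'r measure" where
  "weighted_empirical R K x Xs Ys n h \<omega> =
     distr (point_measure {1..n} (\<lambda>i. ennreal (kernel_weight K x Xs n h \<omega> i))) R (\<lambda>i. Ys i \<omega>)"

definition bias_term ::
  "('g::real_normed_vector \<Rightarrow> 'b) \<Rightarrow> ('c \<Rightarrow> 'g) \<Rightarrow> (real \<Rightarrow> real) \<Rightarrow> 'c::metric_space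
     \<Rightarrow> (nat \<Rightarrow> 'w \<Rightarrow> 'c) \<Rightarrow> nat \<Rightarrow> real \<Rightarrow> 'w \<Rightarrow> 'b" where
  "bias_term L F K x Xs n h \<omega> =
     L ((\<Sum>i=1..n. kernel_weight K x Xs n h \<omega> i *\<^sub>R F (Xs i \<omega>)) - F x)"

definition variance_term ::
  "('g::{banach, second_countable_topology} \<Rightarrow> 'b) \<Rightarrow> ('r \<Rightarrow> 'g) \<Rightarrow> ('c \<Rightarrow> 'r measure)
     \<Rightarrow> (real \<Rightarrow> real) \<Rightarrow> 'c::metric_space \<Rightarrow> (nat \<Rightarrow> 'w \<Rightarrow> 'c) \<Rightarrow> (nat \<Rightarrow> 'w \<Rightarrow> 'r)
     \<Rightarrow> nat \<Rightarrow> real \<Rightarrow> 'w \<Rightarrow> 'b" where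
  "variance_term L G \<kappa> K x Xs Ys n h \<omega> =
     L (\<Sum>i=1..n. kernel_weight K x Xs n h \<omega> i *\<^sub>R (G (Ys i \<omega>) - integral\<^sup>L (\<kappa> (Xs i \<omega>)) G))"

definition mean_bias ::
  "'w measure \<Rightarrow> ('w \<Rightarrow> 'c::metric_space) \<Rightarrow> ('g::{banach, second_countable_topology} \<Rightarrow> 'b)
     \<Rightarrow> ('c \<Rightarrow> 'g) \<Rightarrow> (real \<Rightarrow> real) \<Rightarrow> 'c \<Rightarrow> real \<Rightarrow> 'b" where
  "mean_bias M X L F K x h =
     L (\<integral>\<omega>. (K (dist x (X \<omega>) / h) / (\<integral>\<omega>'. K (dist x (X \<omega>') / h) \<partial>M)) *\<^sub>R (F (X \<omega>) - F x) \<partial>M)"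

definition log_exponent :: "real \<Rightarrow> real \<Rightarrow> real \<Rightarrow> real \<Rightarrow> real" where
  "log_exponent C t\<^sub>2 t\<^sub>3 h = C * (1 / h) powr t\<^sub>2 * (ln (1 / h)) powr t\<^sub>3"

definition bandwidth_objective ::
  "real \<Rightarrow> real \<Rightarrow> real \<Rightarrow> real \<Rightarrow> real \<Rightarrow> real \<Rightarrow> real \<Rightarrow> real \<Rightarrow> nat \<Rightarrow> real \<Rightarrow> real" where
  "bandwidth_objective a b \<beta> C\<^sub>1 C\<^sub>2 t\<^sub>1 t\<^sub>2 t\<^sub>3 n h =
     a * h powr (2 * \<beta>)
       + b / (real n * C\<^sub>1) * (1 / h) powr t\<^sub>1 * exp (log_exponent C\<^sub>2 t\<^sub>2 t\<^sub>3 h)"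

end

theory Submission
  imports Defs
begin

text \<open>The kernel denominators cancel in the quotient, leaving \<open>norm V / norm S\<close> where \<open>V\<close> is the sum of
  the \<open>K\<^sub>i L (G Y\<^sub>i - E (G Y\<^sub>i | X\<^sub>i))\<close> and \<open>S\<close> that of the \<open>K\<^sub>i L (F X\<^sub>i - F x)\<close>; both have i.i.d.
  summands. By type 2 and Chebyshev, \<open>V\<close> is of order \<open>sqrt (n \<phi>)\<close> in probability and \<open>S\<close> deviates
  from its mean by order \<open>h powr \<beta> * sqrt (n \<phi>)\<close>, while the lower bound on the mean bias keeps the
  norm of that mean above a multiple of \<open>n \<phi> * h powr \<beta>\<close>. Hence the quotient is of order
  \<open>1 / sqrt (n \<phi> * h powr (2 * \<beta>))\<close>. The radicand tends to infinity because the variance part of the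
  objective varies faster than any power of \<open>h\<close>, which makes it negligible against \<open>h powr (2 * \<beta>)\<close> at
  the minimizer.\<close>

subsection \<open>Bochner integrals with respect to a mixture of measures\<close>

text \<open>The condition \<open>t\<^sub>2 > 0 \<or> t\<^sub>3 > 1\<close> rules out power laws. If
  \<open>t\<^sub>2 = 0\<close> and \<open>t\<^sub>3 = 1\<close>, the exponential in the objective is
  a power of \<open>1 / h\<close>, both parts of the objective have the same order at the minimizer,
  and \<open>n * \<psi> * h powr (2 * \<beta>)\<close> stays bounded, where \<psi> is the assumed
  lower bound for the small ball probability \<phi>. Beyond powers, a slight relative increase of
  \<open>h\<close> already halves the variance part, while the bias part grows only by a factor near
  1.

  Minimality reaches \<phi> because the variance part equals \<open>b / (n * \<psi>)\<close>. Both
  bandwidth conditions, and with them the mean bias bound, follow from minimality as well.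

  The obstacle on the side of \<open>V\<close> is its centring. Conditional means are integrals
  against \<open>\<kappa> z\<close>, with default value 0 where \<open>G\<close> is not integrable.
  The support of the kernel confines attention to a ball in which the moment bound forces
  integrability; the joint law is then disintegrated so that a vector-valued integrand can be
  integrated over \<open>Y\<close> first.\<close>

lemma AE_integrable_bind:
  fixes f :: "'a \<Rightarrow> 'b::{banach, second_countable_topology}"
  assumes ne: "space M \<noteq> {}" and k[measurable]: "k \<in> M \<rightarrow>\<^sub>M subprob_algebra B"
    and f: "integrable (M \<bind> k) f"
  shows "AE x in M. integrable (k x) f"
proof -
  note sets_kernel[OF k, measurable_cong]
  have [measurable_cong]: "sets (M \<bind> k) = sets B"
    by (rule sets_bind[OF sets_kernel[OF k] ne])
  have fm[measurable]: "f \<in> borel_measurable B"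
    using borel_measurable_integrable[OF f] by measurable
  have "(\<integral>\<^sup>+x. (\<integral>\<^sup>+y. ennreal (norm (f y)) \<partial>k x) \<partial>M) < \<infinity>"
    using f by (subst nn_integral_bind[OF _ k, symmetric]) (auto simp: integrable_iff_bounded)
  moreover have "(\<lambda>x. \<integral>\<^sup>+y. ennreal (norm (f y)) \<partial>k x) \<in> borel_measurable M"
    by (rule measurable_compose[OF k nn_integral_measurable_subprob_algebra]) measurable
  ultimately have "AE x in M. (\<integral>\<^sup>+y. ennreal (norm (f y)) \<partial>k x) \<noteq> \<infinity>"
    by (intro nn_integral_PInf_AE) (auto simp: less_top)
  with AE_space show ?thesis
  proof eventually_elim
    case (elim x)
    then have "f \<in> borel_measurable (k x)"
      using fm by (simp add: measurable_cong_sets[OF sets_kernel[OF k] refl])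
    with elim show ?case by (auto simp: integrable_iff_bounded less_top)
  qed
qed

text \<open>The inner integral is bounded in norm by the inner integral of the norm, which has
  finite integral by Tonelli. The points \<open>x\<close> at which \<open>f\<close> is not
  integrable under \<open>k x\<close> form a null set, so the default value 0 there does no
  harm.\<close>

lemma integrable_integral_bind:
  fixes f :: "'a \<Rightarrow> 'b::{banach, second_countable_topology}"
  assumes ne: "space M \<noteq> {}" and k[measurable]: "k \<in> M \<rightarrow>\<^sub>M subprob_algebra B"
    and f: "integrable (M \<bind> k) f"
  shows "integrable M (\<lambda>x. integral\<^sup>L (k x) f)"
proof (rule integrableI_bounded)
  note sets_kernel[OF k, measurable_cong]
  have [measurable_cong]: "sets (M \<bind> k) = sets B"
    by (rule sets_bind[OF sets_kernel[OF k] ne])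
  have fm[measurable]: "f \<in> borel_measurable B"
    using borel_measurable_integrable[OF f] by measurable
  show "(\<lambda>x. integral\<^sup>L (k x) f) \<in> borel_measurable M"
    by (rule measurable_compose[OF k integral_measurable_subprob_algebra]) measurable
  have "(\<integral>\<^sup>+x. ennreal (norm (integral\<^sup>L (k x) f)) \<partial>M) \<le> (\<integral>\<^sup>+x. (\<integral>\<^sup>+y. ennreal (norm (f y)) \<partial>k x) \<partial>M)"
    using AE_integrable_bind[OF assms]
    by (intro nn_integral_mono_AE) (auto elim!: eventually_mono intro: integral_norm_bound_ennreal)
  also have "\<dots> < \<infinity>"
    using f by (subst nn_integral_bind[OF _ k, symmetric]) (auto simp: integrable_iff_bounded)
  finally show "(\<integral>\<^sup>+x. ennreal (norm (integral\<^sup>L (k x) f)) \<partial>M) < \<infinity>" .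
qed

text \<open>The library's \<open>integral_bind\<close> is restricted to bounded real functions.\<close>
lemma integral_bind_integrable:
  fixes f :: "'a \<Rightarrow> 'b::{banach, second_countable_topology}"
  assumes ne: "space M \<noteq> {}" and k[measurable]: "k \<in> M \<rightarrow>\<^sub>M subprob_algebra B"
    and f: "integrable (M \<bind> k) f"
  shows "integral\<^sup>L (M \<bind> k) f = (\<integral>x. integral\<^sup>L (k x) f \<partial>M)"
proof -
  note sets_kernel[OF k, measurable_cong]
  have sets[measurable_cong, simp]: "sets (M \<bind> k) = sets B"
    by (rule sets_bind[OF sets_kernel[OF k] ne])
  have space[simp]: "space (M \<bind> k) = space B" "\<And>x. x \<in> space M \<Longrightarrow> space (k x) = space B"
    using sets_eq_imp_space_eq[OF sets] sets_eq_imp_space_eq[OF sets_kernel[OF k]] by auto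
  have [measurable]: "(\<lambda>x. integral\<^sup>L (k x) g) \<in> borel_measurable M"
    if "g \<in> borel_measurable B" for g :: "'a \<Rightarrow> 'b"
    using that by (intro measurable_compose[OF k integral_measurable_subprob_algebra])
  \<comment> \<open>Induction over indicators of sets of finite measure, sums, and dominated limits,
    following the construction of the Bochner integral.\<close>
  show ?thesis using f
  proof induct
    case (base A c)
    then have A[measurable]: "A \<in> sets B" by simp
    have "(\<integral>x. (\<integral>y. indicator A y *\<^sub>R c \<partial>k x) \<partial>M) = (\<integral>x. measure (k x) A *\<^sub>R c \<partial>M)"
    proof (intro Bochner_Integration.integral_cong refl)
      fix x assume x: "x \<in> space M"
      then have "subprob_space (k x)" by (rule subprob_space_kernel[OF k])
      then interpret subprob_space "k x" .
      show "(\<integral>y. indicator A y *\<^sub>R c \<partial>k x) = measure (k x) A *\<^sub>R c"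
        using x A by (simp add: sets_kernel[OF k] less_top[symmetric])
    qed
    also have "\<dots> = measure (M \<bind> k) A *\<^sub>R c"
    proof -
      have "emeasure (M \<bind> k) A = (\<integral>\<^sup>+x. emeasure (k x) A \<partial>M)"
        by (rule emeasure_bind[OF ne k A])
      also have "\<dots> = (\<integral>\<^sup>+x. ennreal (measure (k x) A) \<partial>M)"
      proof (intro nn_integral_cong)
        fix x assume x: "x \<in> space M"
        then have "subprob_space (k x)" by (rule subprob_space_kernel[OF k])
        then interpret subprob_space "k x" .
        show "emeasure (k x) A = ennreal (measure (k x) A)"
          by (rule emeasure_eq_measure)
      qed
      finally have *: "emeasure (M \<bind> k) A = (\<integral>\<^sup>+x. ennreal (measure (k x) A) \<partial>M)" .
      \<comment> \<open>\<open>M\<close> is an arbitrary measure, so integrability has to come from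
        the finite mass of \<open>A\<close> under the mixture, which the base case provides.\<close>
      have int: "integrable M (\<lambda>x. measure (k x) A)"
        using base * by (simp add: integrable_iff_bounded)
      then have "emeasure (M \<bind> k) A = ennreal (\<integral>x. measure (k x) A \<partial>M)"
        unfolding * by (rule nn_integral_eq_integral) simp
      then have "measure (M \<bind> k) A = (\<integral>x. measure (k x) A \<partial>M)"
        by (simp add: measure_def integral_nonneg_AE)
      with int show ?thesis by simp
    qed
    also have "\<dots> = (\<integral>y. indicator A y *\<^sub>R c \<partial>(M \<bind> k))"
      using base by simp
    finally show ?case by simp
  next
    case (add f g)
    then have [measurable]: "f \<in> borel_measurable B" "g \<in> borel_measurable B"
      using add(1,3)[THEN borel_measurable_integrable] by simp_all
    have "(\<integral>x. (\<integral>y. f y + g y \<partial>k x) \<partial>M) = (\<integral>x. integral\<^sup>L (k x) f + integral\<^sup>L (k x) g \<partial>M)"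
      using AE_integrable_bind[OF ne k add(1)] AE_integrable_bind[OF ne k add(3)]
      by (intro integral_cong_AE) (auto elim: eventually_elim2)
    with add integrable_integral_bind[OF ne k add(1)] integrable_integral_bind[OF ne k add(3)]
    show ?case by simp
  next
    case (lim f s)
    then have [measurable]: "f \<in> borel_measurable B" "\<And>i. s i \<in> borel_measurable B"
      using lim(1,5)[THEN borel_measurable_integrable] by simp_all
    show ?case
    proof (rule LIMSEQ_unique)
      show "(\<lambda>i. integral\<^sup>L (M \<bind> k) (s i)) \<longlonglongrightarrow> integral\<^sup>L (M \<bind> k) f"
        using lim by (intro integral_dominated_convergence[where w="\<lambda>x. 2 * norm (f x)"]) auto
      \<comment> \<open>The induction supplies approximants with
        \<open>norm (s i x) \<le> 2 * norm (f x)\<close>. This bound dominates the inner limit for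
        almost every \<open>x\<close>, and its inner integral dominates the outer limit.\<close>
      have int2: "integrable (M \<bind> k) (\<lambda>x. 2 * norm (f x))"
        using lim(5) by auto
      have "(\<lambda>i. \<integral>x. integral\<^sup>L (k x) (s i) \<partial>M) \<longlonglongrightarrow> (\<integral>x. integral\<^sup>L (k x) f \<partial>M)"
      proof (rule integral_dominated_convergence)
        show "integrable M (\<lambda>x. \<integral>y. 2 * norm (f y) \<partial>k x)"
          by (rule integrable_integral_bind[OF ne k int2])
        show "AE x in M. (\<lambda>i. integral\<^sup>L (k x) (s i)) \<longlonglongrightarrow> integral\<^sup>L (k x) f"
          using AE_space AE_integrable_bind[OF ne k int2]
        proof eventually_elim
          case (elim x)
          then show ?case
            using lim(3,4) 
            by (intro integral_dominated_convergence[where w="\<lambda>x. 2 * norm (f x)"])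
               (auto simp: measurable_cong_sets[OF sets_kernel[OF k] refl])
        qed
        fix i show "AE x in M. norm (integral\<^sup>L (k x) (s i)) \<le> (\<integral>y. 2 * norm (f y) \<partial>k x)"
          using AE_space AE_integrable_bind[OF ne k int2] AE_integrable_bind[OF ne k lim(1)[of i]]
        proof eventually_elim
          case (elim x)
          then show ?case
            using lim(4)
            by (intro order_trans[OF integral_norm_bound] integral_mono) auto
        qed
      qed auto
      then show "(\<lambda>i. integral\<^sup>L (M \<bind> k) (s i)) \<longlonglongrightarrow> (\<integral>x. integral\<^sup>L (k x) f \<partial>M)"
        using lim(2) by simp
    qed
  qed
qed

text \<open>Disintegration of the joint law. \<open>regular_cond_dist\<close> speaks of rectangles
  only; these form an intersection-stable generator containing the whole space, which has finite
  mass, so agreement on them suffices. \<open>Pair (X \<omega>)\<close> freezes the first coordinate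
  on each fibre, so that functions of both coordinates can be integrated over the second
  alone.\<close>

lemma
  fixes X :: "'w \<Rightarrow> 'c::polish_space"
  assumes "prob_space M" and XY: "(\<lambda>\<omega>. (X \<omega>, Y \<omega>)) \<in> M \<rightarrow>\<^sub>M borel \<Otimes>\<^sub>M R"
    and rcd: "regular_cond_dist M R X Y \<kappa>"
  shows distr_pair_eq_bind: "distr M (borel \<Otimes>\<^sub>M R) (\<lambda>\<omega>. (X \<omega>, Y \<omega>)) =
    M \<bind> (\<lambda>\<omega>. distr (\<kappa> (X \<omega>)) (borel \<Otimes>\<^sub>M R) (Pair (X \<omega>)))"
    and measurable_cond_pair: "(\<lambda>\<omega>. distr (\<kappa> (X \<omega>)) (borel \<Otimes>\<^sub>M R) (Pair (X \<omega>))) \<in> M \<rightarrow>\<^sub>M subprob_algebra (borel \<Otimes>\<^sub>M R)"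
proof -
  interpret prob_space M by fact
  have \<kappa>: "\<kappa> \<in> borel \<rightarrow>\<^sub>M prob_algebra R"
    using rcd by (simp add: regular_cond_dist_def)
  note XY[measurable]
  have X[measurable]: "X \<in> borel_measurable M" and Y[measurable]: "Y \<in> M \<rightarrow>\<^sub>M R"
    using measurable_compose[OF XY measurable_fst] measurable_compose[OF XY measurable_snd] by simp_all
  have \<kappa>'[measurable]: "\<kappa> \<in> borel \<rightarrow>\<^sub>M subprob_algebra R"
    using \<kappa> by (rule measurable_prob_algebraD)
  show k: "(\<lambda>\<omega>. distr (\<kappa> (X \<omega>)) (borel \<Otimes>\<^sub>M R) (Pair (X \<omega>))) \<in> M \<rightarrow>\<^sub>M subprob_algebra (borel \<Otimes>\<^sub>M R)"
    by (rule measurable_distr2[where M=R]) measurable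
  have sets\<kappa>[measurable_cong]: "sets (\<kappa> z) = sets R" for z
    using measurable_space[OF \<kappa>, of z] by (simp add: space_prob_algebra)
  show "distr M (borel \<Otimes>\<^sub>M R) (\<lambda>\<omega>. (X \<omega>, Y \<omega>)) = M \<bind> (\<lambda>\<omega>. distr (\<kappa> (X \<omega>)) (borel \<Otimes>\<^sub>M R) (Pair (X \<omega>)))"
  proof (rule measure_eqI_generator_eq[OF Int_stable_pair_measure_generator[of borel R],
        where A="\<lambda>_. space borel \<times> space R"])
    fix E assume "E \<in> {A \<times> B |A B. A \<in> sets (borel :: 'c measure) \<and> B \<in> sets R}"
    then obtain A B where E: "E = A \<times> B" and [measurable]: "A \<in> sets borel" "B \<in> sets R" by auto
    have "emeasure (distr M (borel \<Otimes>\<^sub>M R) (\<lambda>\<omega>. (X \<omega>, Y \<omega>))) E =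
        emeasure M {\<omega> \<in> space M. X \<omega> \<in> A \<and> Y \<omega> \<in> B}"
      unfolding E by (subst emeasure_distr) (auto intro!: arg_cong[where f="emeasure M"])
    also have "\<dots> = (\<integral>\<^sup>+\<omega>. indicator A (X \<omega>) * emeasure (\<kappa> (X \<omega>)) B \<partial>M)"
      using rcd by (simp add: regular_cond_dist_def)
    also have "\<dots> = (\<integral>\<^sup>+\<omega>. emeasure (distr (\<kappa> (X \<omega>)) (borel \<Otimes>\<^sub>M R) (Pair (X \<omega>))) E \<partial>M)"
    proof (intro nn_integral_cong)
      fix \<omega>
      have "Pair (X \<omega>) -` (A \<times> B) \<inter> space (\<kappa> (X \<omega>)) = (if X \<omega> \<in> A then B else {})"
        using sets.sets_into_space[of B R] sets_eq_imp_space_eq[OF sets\<kappa>[of "X \<omega>"]] by auto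
      then show "indicator A (X \<omega>) * emeasure (\<kappa> (X \<omega>)) B =
          emeasure (distr (\<kappa> (X \<omega>)) (borel \<Otimes>\<^sub>M R) (Pair (X \<omega>))) E"
        unfolding E by (subst emeasure_distr) auto
    qed
    also have "\<dots> = emeasure (M \<bind> (\<lambda>\<omega>. distr (\<kappa> (X \<omega>)) (borel \<Otimes>\<^sub>M R) (Pair (X \<omega>)))) E"
      unfolding E by (intro emeasure_bind[symmetric, OF _ k]) (auto simp: not_empty)
    finally show "emeasure (distr M (borel \<Otimes>\<^sub>M R) (\<lambda>\<omega>. (X \<omega>, Y \<omega>))) E =
      emeasure (M \<bind> (\<lambda>\<omega>. distr (\<kappa> (X \<omega>)) (borel \<Otimes>\<^sub>M R) (Pair (X \<omega>)))) E" .
  next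
    interpret D: prob_space "distr M (borel \<Otimes>\<^sub>M R) (\<lambda>\<omega>. (X \<omega>, Y \<omega>))"
      by (rule prob_space_distr) measurable
    show "emeasure (distr M (borel \<Otimes>\<^sub>M R) (\<lambda>\<omega>. (X \<omega>, Y \<omega>))) (space borel \<times> space R) \<noteq> \<infinity>"
      by (simp add: D.emeasure_eq_measure)
  next
    show "{A \<times> B |A B. A \<in> sets (borel :: 'c measure) \<and> B \<in> sets R} \<subseteq> Pow (space borel \<times> space R)"
      using sets.sets_into_space[of _ R] by fastforce
    show "sets (distr M (borel \<Otimes>\<^sub>M R) (\<lambda>\<omega>. (X \<omega>, Y \<omega>))) =
        sigma_sets (space borel \<times> space R) {A \<times> B |A B. A \<in> sets borel \<and> B \<in> sets R}"
      by (simp add: sets_pair_measure)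
    show "sets (M \<bind> (\<lambda>\<omega>. distr (\<kappa> (X \<omega>)) (borel \<Otimes>\<^sub>M R) (Pair (X \<omega>)))) =
        sigma_sets (space borel \<times> space R) {A \<times> B |A B. A \<in> sets borel \<and> B \<in> sets R}"
      by (subst sets_bind[OF sets_kernel[OF k]]) (auto simp: sets_pair_measure not_empty)
    show "range (\<lambda>_. space borel \<times> space R) \<subseteq> {A \<times> B |A B. A \<in> sets (borel :: 'c measure) \<and> B \<in> sets R}"
      by blast
  qed auto
qed

subsection \<open>Sums of independent vectors in spaces of type 2\<close>

text \<open>Transfer from measures on \<open>nat \<Rightarrow> 'b\<close> to any probability space:
  under the law of the sequence, the coordinates have the same joint distribution as the given
  vectors. The constant is fixed before the space, the vectors and \<open>n\<close>.\<close>

lemma type_two_sum: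
  assumes "type_two TYPE('b::{banach, second_countable_topology})"
  obtains c where "c > 0" "\<And>(M :: 'w measure) (Z :: nat \<Rightarrow> 'w \<Rightarrow> 'b) n.
    prob_space M \<Longrightarrow> prob_space.indep_vars M (\<lambda>_. borel) Z {1..n} \<Longrightarrow>
    (\<And>i. i \<in> {1..n} \<Longrightarrow> integrable M (\<lambda>\<omega>. (norm (Z i \<omega>))\<^sup>2)) \<Longrightarrow>
    (\<And>i. i \<in> {1..n} \<Longrightarrow> integral\<^sup>L M (Z i) = 0) \<Longrightarrow>
    (\<integral>\<omega>. (norm (\<Sum>i=1..n. Z i \<omega>))\<^sup>2 \<partial>M) \<le> c * (\<Sum>i=1..n. \<integral>\<omega>. (norm (Z i \<omega>))\<^sup>2 \<partial>M)"
proof -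
  from assms obtain c where "c > 0" and c: "\<And>(P :: (nat \<Rightarrow> 'b) measure) (Z :: nat \<Rightarrow> (nat \<Rightarrow> 'b) \<Rightarrow> 'b) n.
    prob_space P \<Longrightarrow> prob_space.indep_vars P (\<lambda>_. borel) Z {1..n} \<Longrightarrow>
    (\<forall>i\<in>{1..n}. integrable P (\<lambda>\<omega>. (norm (Z i \<omega>))\<^sup>2) \<and> integral\<^sup>L P (Z i) = 0) \<Longrightarrow>
    integral\<^sup>L P (\<lambda>\<omega>. (norm (\<Sum>i=1..n. Z i \<omega>))\<^sup>2)
      \<le> c * (\<Sum>i=1..n. integral\<^sup>L P (\<lambda>\<omega>. (norm (Z i \<omega>))\<^sup>2))"
    unfolding type_two_def by blast
  show thesis
  proof (rule that[OF \<open>c > 0\<close>])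
    fix M :: "'w measure" and Z :: "nat \<Rightarrow> 'w \<Rightarrow> 'b" and n
    assume "prob_space M"
    then interpret prob_space M .
    assume indep: "indep_vars (\<lambda>_. borel) Z {1..n}"
      and int: "\<And>i. i \<in> {1..n} \<Longrightarrow> integrable M (\<lambda>\<omega>. (norm (Z i \<omega>))\<^sup>2)"
      and mean: "\<And>i. i \<in> {1..n} \<Longrightarrow> integral\<^sup>L M (Z i) = 0"
    have Zm: "\<And>i. i \<in> {1..n} \<Longrightarrow> Z i \<in> borel_measurable M"
      using indep by (auto simp: indep_vars_def)
    \<comment> \<open>Padding with 0 makes the whole sequence measurable; nothing is known about
      \<open>Z i\<close> outside \<open>{1..n}\<close>.\<close>
    define J where "J = (\<lambda>\<omega> i. if i \<in> {1..n} then Z i \<omega> else 0)"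
    define P where "P = distr M (\<Pi>\<^sub>M i\<in>UNIV. borel :: 'b measure) J"
    have J_eq: "J \<omega> i = Z i \<omega>" if "Suc 0 \<le> i" "i \<le> n" for \<omega> i
      using that by (simp add: J_def)
    have [measurable]: "(\<lambda>\<omega>. J \<omega> i) \<in> borel_measurable M" for i
      using Zm[of i] by (cases "i \<in> {1..n}") (auto simp: J_def)
    have J[measurable]: "J \<in> M \<rightarrow>\<^sub>M (\<Pi>\<^sub>M i\<in>UNIV. borel)"
      by (rule measurable_PiM_single') (auto simp: space_PiM)
    interpret P: prob_space P unfolding P_def by (rule prob_space_distr) (rule J)
    have comp[measurable]: "(\<lambda>f. f i) \<in> borel_measurable (\<Pi>\<^sub>M i\<in>UNIV. borel :: 'b measure)" for i :: nat
      by (rule measurable_component_singleton) simp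
    have sets[measurable_cong]: "sets P = sets (\<Pi>\<^sub>M i\<in>UNIV. borel :: 'b measure)"
      by (simp add: P_def)
    have distr: "distr P borel (\<lambda>f. f i) = distr M borel (Z i)" if "i \<in> {1..n}" for i
      unfolding P_def using that by (subst distr_distr) (auto simp: comp_def J_eq intro!: distr_cong)
    have "P.indep_vars (\<lambda>_. borel) (\<lambda>i f. f i) {1..n}"
    \<comment> \<open>Independence is read off from the joint law being a product, a criterion that
      requires a nonempty index set.\<close>
    proof (cases "n = 0")
      case False
      then have ne: "{1..n} \<noteq> {}" by simp
      have "distr P (\<Pi>\<^sub>M i\<in>{1..n}. borel) (\<lambda>f. \<lambda>i\<in>{1..n}. f i) =
          distr M (\<Pi>\<^sub>M i\<in>{1..n}. borel) (\<lambda>\<omega>. \<lambda>i\<in>{1..n}. Z i \<omega>)"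
        unfolding P_def by (subst distr_distr) (auto simp: comp_def J_eq intro!: distr_cong ext)
      also have "\<dots> = (\<Pi>\<^sub>M i\<in>{1..n}. distr M borel (Z i))"
        using indep by (subst indep_vars_iff_distr_eq_PiM'[OF ne, symmetric]) (auto intro: Zm)
      also have "\<dots> = (\<Pi>\<^sub>M i\<in>{1..n}. distr P borel (\<lambda>f. f i))"
        by (intro PiM_cong) (auto simp: distr)
      finally show ?thesis
        by (subst P.indep_vars_iff_distr_eq_PiM'[OF ne]) auto
    qed (auto simp: P.indep_vars_def P.indep_sets_def)
    moreover have "integrable P (\<lambda>f. (norm (f i))\<^sup>2) \<and> (\<integral>f. f i \<partial>P) = 0" if "i \<in> {1..n}" for i
      unfolding P_def using int[OF that] mean[OF that] that
      by (simp add: integrable_distr_eq integral_distr J_eq)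
    ultimately have "integral\<^sup>L P (\<lambda>f. (norm (\<Sum>i=1..n. f i))\<^sup>2)
        \<le> c * (\<Sum>i=1..n. integral\<^sup>L P (\<lambda>f. (norm (f i))\<^sup>2))"
      using c[OF P.prob_space_axioms, of "\<lambda>i f. f i"] by blast
    also have "(\<Sum>i=1..n. integral\<^sup>L P (\<lambda>f. (norm (f i))\<^sup>2)) = (\<Sum>i=1..n. \<integral>\<omega>. (norm (Z i \<omega>))\<^sup>2 \<partial>M)"
      unfolding P_def by (intro sum.cong refl) (simp add: integral_distr J_eq)
    also have "integral\<^sup>L P (\<lambda>f. (norm (\<Sum>i=1..n. f i))\<^sup>2) = (\<integral>\<omega>. (norm (\<Sum>i=1..n. Z i \<omega>))\<^sup>2 \<partial>M)"
      unfolding P_def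
      by (subst integral_distr) (auto intro!: Bochner_Integration.integral_cong arg_cong[where f="\<lambda>z. (norm z)\<^sup>2"] sum.cong simp: J_eq)
    finally show "(\<integral>\<omega>. (norm (\<Sum>i=1..n. Z i \<omega>))\<^sup>2 \<partial>M) \<le> c * (\<Sum>i=1..n. \<integral>\<omega>. (norm (Z i \<omega>))\<^sup>2 \<partial>M)" .
  qed
qed

text \<open>Without an inner product, centring need not decrease the second moment. The factor 4
  comes from \<open>(s + t)\<^sup>2 \<le> 2 * s\<^sup>2 + 2 * t\<^sup>2\<close> together with
  Jensen's inequality, the latter obtained from the nonnegative variance of the real variable
  \<open>norm (f x)\<close>.\<close>

lemma (in prob_space) integral_norm_diff_expectation_le:
  fixes f :: "'a \<Rightarrow> 'b::{banach, second_countable_topology}"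
  assumes [measurable]: "f \<in> borel_measurable M" and sq: "integrable M (\<lambda>x. (norm (f x))\<^sup>2)"
  shows "integrable M f" "integrable M (\<lambda>x. (norm (f x - expectation f))\<^sup>2)"
    "expectation (\<lambda>x. (norm (f x - expectation f))\<^sup>2) \<le> 4 * expectation (\<lambda>x. (norm (f x))\<^sup>2)"
proof -
  have nf: "integrable M (\<lambda>x. norm (f x))"
    by (rule square_integrable_imp_integrable[OF _ sq]) simp
  then show "integrable M f" by (simp add: integrable_norm_iff)
  have "(norm (expectation f))\<^sup>2 \<le> (expectation (\<lambda>x. norm (f x)))\<^sup>2"
    by (intro power_mono integral_norm_bound) auto
  also have "\<dots> \<le> expectation (\<lambda>x. (norm (f x))\<^sup>2)"
    using variance_eq[OF nf sq] variance_positive[of "\<lambda>x. norm (f x)"] by simp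
  finally have E: "(norm (expectation f))\<^sup>2 \<le> expectation (\<lambda>x. (norm (f x))\<^sup>2)" .
  have pw: "(norm (f x - expectation f))\<^sup>2 \<le> 2 * (norm (f x))\<^sup>2 + 2 * (norm (expectation f))\<^sup>2" for x
  proof -
    have "(norm (f x - expectation f))\<^sup>2 \<le> (norm (f x) + norm (expectation f))\<^sup>2"
      by (intro power_mono norm_triangle_ineq4) auto
    also have "\<dots> \<le> 2 * (norm (f x))\<^sup>2 + 2 * (norm (expectation f))\<^sup>2"
      using sum_squares_bound[of "norm (f x)" "norm (expectation f)"] by (simp add: power2_sum)
    finally show ?thesis .
  qed
  have int: "integrable M (\<lambda>x. 2 * (norm (f x))\<^sup>2 + 2 * (norm (expectation f))\<^sup>2)"
    using sq by simp
  show sq': "integrable M (\<lambda>x. (norm (f x - expectation f))\<^sup>2)"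
    by (rule Bochner_Integration.integrable_bound[OF int]) (use pw in \<open>auto intro!: AE_I2\<close>)
  have "expectation (\<lambda>x. (norm (f x - expectation f))\<^sup>2) \<le>
      expectation (\<lambda>x. 2 * (norm (f x))\<^sup>2 + 2 * (norm (expectation f))\<^sup>2)"
    by (intro integral_mono sq' int pw)
  also have "\<dots> = 2 * expectation (\<lambda>x. (norm (f x))\<^sup>2) + 2 * (norm (expectation f))\<^sup>2"
    using sq by (simp add: prob_space)
  finally show "expectation (\<lambda>x. (norm (f x - expectation f))\<^sup>2) \<le> 4 * expectation (\<lambda>x. (norm (f x))\<^sup>2)"
    using E by simp
qed

text \<open>Chebyshev's inequality with type 2 in place of additivity of variances. It matters that
  \<open>c\<close> is chosen before \<open>f\<close>, \<open>n\<close> and \<open>t\<close>: the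
  summands change with \<open>n\<close> through the bandwidth. Moments are taken under the common
  law \<open>D\<close>, so the copies never have to be treated one by one.\<close>

lemma type_two_iid_tail:
  assumes "type_two TYPE('b::{banach, second_countable_topology})"
  obtains c where "c > 0"
    "\<And>(M :: 'w measure) (N :: 'a measure) D U (f :: 'a \<Rightarrow> 'b) n t.
      prob_space M \<Longrightarrow> prob_space.indep_vars M (\<lambda>_. N) U {1..} \<Longrightarrow>
      (\<And>i. i \<ge> 1 \<Longrightarrow> distr M N (U i) = D) \<Longrightarrow> f \<in> borel_measurable N \<Longrightarrow>
      integrable D (\<lambda>u. (norm (f u))\<^sup>2) \<Longrightarrow> t > 0 \<Longrightarrow>
      measure M {\<omega> \<in> space M. t \<le> norm ((\<Sum>i=1..n. f (U i \<omega>)) - real n *\<^sub>R integral\<^sup>L D f)}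
        \<le> c * (real n * (\<integral>u. (norm (f u))\<^sup>2 \<partial>D)) / t\<^sup>2"
proof -
  obtain c where c: "c > 0" "\<And>(M :: 'w measure) (Z :: nat \<Rightarrow> 'w \<Rightarrow> 'b) n.
    prob_space M \<Longrightarrow> prob_space.indep_vars M (\<lambda>_. borel) Z {1..n} \<Longrightarrow>
    (\<And>i. i \<in> {1..n} \<Longrightarrow> integrable M (\<lambda>\<omega>. (norm (Z i \<omega>))\<^sup>2)) \<Longrightarrow>
    (\<And>i. i \<in> {1..n} \<Longrightarrow> integral\<^sup>L M (Z i) = 0) \<Longrightarrow>
    (\<integral>\<omega>. (norm (\<Sum>i=1..n. Z i \<omega>))\<^sup>2 \<partial>M) \<le> c * (\<Sum>i=1..n. \<integral>\<omega>. (norm (Z i \<omega>))\<^sup>2 \<partial>M)"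
    using type_two_sum[OF assms] by blast
  show thesis
  proof (rule that[of "4 * c"])
    fix M :: "'w measure" and N :: "'a measure" and D and U :: "nat \<Rightarrow> 'w \<Rightarrow> 'a" and f :: "'a \<Rightarrow> 'b" and n and t :: real
    assume "prob_space M"
    then interpret prob_space M .
    assume indep: "indep_vars (\<lambda>_. N) U {1..}"
      and D: "\<And>i. i \<ge> 1 \<Longrightarrow> distr M N (U i) = D"
      and f[measurable]: "f \<in> borel_measurable N"
      and sq: "integrable D (\<lambda>u. (norm (f u))\<^sup>2)" and "t > 0"
    have U: "U i \<in> M \<rightarrow>\<^sub>M N" if "i \<ge> 1" for i
      using indep that by (auto simp: indep_vars_def)
    have sets[measurable_cong]: "sets D = sets N" using arg_cong[OF D[of 1], of sets] by simp
    interpret D: prob_space D using prob_space_distr[OF U[of 1]] D[of 1] by simp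
    define m where "m = integral\<^sup>L D f"
    define Z where "Z = (\<lambda>i \<omega>. f (U i \<omega>) - m)"
    have fD[measurable]: "f \<in> borel_measurable D" by measurable
    note E = D.integral_norm_diff_expectation_le[OF fD sq, folded m_def]
    have U1[measurable]: "U i \<in> M \<rightarrow>\<^sub>M N" if "i \<in> {1..n}" for i using U[of i] that by simp
    have Z[measurable]: "Z i \<in> borel_measurable M" if "i \<in> {1..n}" for i
      unfolding Z_def using U1[OF that] by measurable
    have ZD: "integrable M (\<lambda>\<omega>. g (U i \<omega>)) \<longleftrightarrow> integrable D g" "(\<integral>\<omega>. g (U i \<omega>) \<partial>M) = integral\<^sup>L D g"
      if "i \<in> {1..n}" and [measurable]: "g \<in> borel_measurable N"
      for i and g :: "'a \<Rightarrow> 'd::{banach, second_countable_topology}"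
      using that U1[OF that(1)] D[of i] integrable_distr_eq[of "U i" M N g] integral_distr[of "U i" M N g] by auto
    have Zsq: "integrable M (\<lambda>\<omega>. (norm (Z i \<omega>))\<^sup>2)" if "i \<in> {1..n}" for i
      unfolding Z_def using that E(2) ZD(1)[of i "\<lambda>u. (norm (f u - m))\<^sup>2"] by simp
    have Z0: "integral\<^sup>L M (Z i) = 0" if "i \<in> {1..n}" for i
      unfolding Z_def using that E(1) ZD(2)[of i "\<lambda>u. f u - m"] by (simp add: m_def D.prob_space)
    have ZE: "(\<integral>\<omega>. (norm (Z i \<omega>))\<^sup>2 \<partial>M) \<le> 4 * (\<integral>u. (norm (f u))\<^sup>2 \<partial>D)" if "i \<in> {1..n}" for i
      unfolding Z_def using that E(3) ZD(2)[of i "\<lambda>u. (norm (f u - m))\<^sup>2"] by simp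
    have "indep_vars (\<lambda>_. borel) Z {1..n}"
      unfolding Z_def
      by (rule indep_vars_compose2[where Y="\<lambda>i u. f u - m", OF indep_vars_subset[OF indep]]) auto
    from c(2)[OF prob_space_axioms this Zsq Z0]
    have "(\<integral>\<omega>. (norm (\<Sum>i=1..n. Z i \<omega>))\<^sup>2 \<partial>M) \<le> c * (\<Sum>i=1..n. \<integral>\<omega>. (norm (Z i \<omega>))\<^sup>2 \<partial>M)"
      by blast
    also have "\<dots> \<le> c * (\<Sum>i=1..n. 4 * (\<integral>u. (norm (f u))\<^sup>2 \<partial>D))"
      using c(1) by (intro mult_left_mono sum_mono ZE) auto
    finally have sum: "(\<integral>\<omega>. (norm (\<Sum>i=1..n. Z i \<omega>))\<^sup>2 \<partial>M) \<le> 4 * c * (real n * (\<integral>u. (norm (f u))\<^sup>2 \<partial>D))"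
      by simp
    \<comment> \<open>The type 2 inequality alone bounds nothing here, since the integral of a
      non-integrable square would be 0 by default. Cauchy-Schwarz supplies the integrability that
      Markov's inequality needs.\<close>
    have "integrable M (\<lambda>\<omega>. (\<Sum>i=1..n. (norm (Z i \<omega>))\<^sup>2) * real n)"
      using Zsq by (intro integrable_mult_left Bochner_Integration.integrable_sum) auto
    then have int: "integrable M (\<lambda>\<omega>. (norm (\<Sum>i=1..n. Z i \<omega>))\<^sup>2)"
    proof (rule Bochner_Integration.integrable_bound)
      show "AE \<omega> in M. norm ((norm (\<Sum>i=1..n. Z i \<omega>))\<^sup>2) \<le> norm ((\<Sum>i=1..n. (norm (Z i \<omega>))\<^sup>2) * real n)"
      proof (rule AE_I2)
        fix \<omega>
        have "(norm (\<Sum>i=1..n. Z i \<omega>))\<^sup>2 \<le> (\<Sum>i=1..n. norm (Z i \<omega>))\<^sup>2"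
          by (intro power_mono norm_sum) auto
        also have "\<dots> \<le> (\<Sum>i=1..n. (norm (Z i \<omega>))\<^sup>2) * real n"
          using sum_squared_le_sum_of_squares[of "\<lambda>i. norm (Z i \<omega>)" "{1..n}"] by simp
        finally show "norm ((norm (\<Sum>i=1..n. Z i \<omega>))\<^sup>2) \<le> norm ((\<Sum>i=1..n. (norm (Z i \<omega>))\<^sup>2) * real n)"
          by simp
      qed
    qed measurable
    have eq: "(\<Sum>i=1..n. f (U i \<omega>)) - real n *\<^sub>R m = (\<Sum>i=1..n. Z i \<omega>)" for \<omega>
      by (simp add: Z_def sum_subtractf sum_constant_scaleR)
    have "measure M {\<omega> \<in> space M. t \<le> norm (\<Sum>i=1..n. Z i \<omega>)}
        = measure M {\<omega> \<in> space M. t\<^sup>2 \<le> (norm (\<Sum>i=1..n. Z i \<omega>))\<^sup>2}"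
      using \<open>t > 0\<close> by (simp add: abs_le_square_iff[symmetric])
    also have "\<dots> \<le> (\<integral>\<omega>. (norm (\<Sum>i=1..n. Z i \<omega>))\<^sup>2 \<partial>M) / t\<^sup>2"
      by (rule integral_Markov_inequality_measure[OF int, where A="{}"]) (use \<open>t > 0\<close> in auto)
    also have "\<dots> \<le> 4 * c * (real n * (\<integral>u. (norm (f u))\<^sup>2 \<partial>D)) / t\<^sup>2"
      by (intro divide_right_mono sum) auto
    finally show "measure M {\<omega> \<in> space M. t \<le> norm ((\<Sum>i=1..n. f (U i \<omega>)) - real n *\<^sub>R integral\<^sup>L D f)}
        \<le> 4 * c * (real n * (\<integral>u. (norm (f u))\<^sup>2 \<partial>D)) / t\<^sup>2"
      unfolding m_def[symmetric] eq .
  qed (use c(1) in simp)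
qed

subsection \<open>The optimum bandwidth\<close>

text \<open>It suffices to replace \<open>(u - \<delta>) powr (p - 1)\<close> by the larger
  \<open>u powr (p - 1)\<close>. Applied with \<open>u = ln (1 / s)\<close> and
  \<open>\<delta> = ln c\<close>, where scaling \<open>s\<close> by \<open>c\<close> is a
  shift.\<close>

lemma powr_diff_ge:
  fixes u \<delta> p :: real
  assumes "0 \<le> \<delta>" "\<delta> < u" "1 \<le> p"
  shows "\<delta> * u powr (p - 1) \<le> u powr p - (u - \<delta>) powr p"
proof -
  have "(u - \<delta>) powr p = (u - \<delta>) * (u - \<delta>) powr (p - 1)"
    using assms powr_mult_base[of "u - \<delta>" "p - 1"] by simp
  also have "\<dots> \<le> (u - \<delta>) * u powr (p - 1)"
    using assms by (intro mult_left_mono powr_mono2) auto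
  also have "\<dots> = u powr p - \<delta> * u powr (p - 1)"
    using assms powr_mult_base[of u "p - 1"] by (simp add: algebra_simps)
  finally show ?thesis by simp
qed

lemma filterlim_powr_at_top:
  fixes p :: real
  assumes "p > 0"
  shows "filterlim (\<lambda>u::real. u powr p) at_top at_top"
proof -
  have "filterlim (\<lambda>u::real. exp (p * ln u)) at_top at_top"
    by (intro filterlim_compose[OF exp_at_top]
        filterlim_tendsto_pos_mult_at_top[OF tendsto_const assms ln_at_top])
  then show ?thesis
  proof (rule filterlim_at_top_mono)
    show "\<forall>\<^sub>F u::real in at_top. exp (p * ln u) \<le> u powr p"
      using eventually_gt_at_top[of 0] by eventually_elim (simp add: powr_def)
  qed
qed

lemma filterlim_ln_inverse_at_right_0:
  "filterlim (\<lambda>s::real. ln (1 / s)) at_top (at_right 0)"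
  by (rule filterlim_compose[OF ln_at_top])
     (simp add: divide_inverse filterlim_inverse_at_top_right)

text \<open>If \<open>t\<^sub>2 > 0\<close>, passing from \<open>s\<close> to \<open>c * s\<close>
  multiplies \<open>(1 / s) powr t\<^sub>2\<close> by a factor below 1, and the loss is a fixed
  multiple of a divergent quantity. If \<open>t\<^sub>2 = 0\<close>, it shifts the logarithm by
  \<open>ln c\<close>, and a shift changes a power above 1 by an unbounded amount; for
  \<open>t\<^sub>3 = 1\<close> the gap would be the constant \<open>C * ln c\<close>.\<close>

lemma log_exponent_gap_at_top:
  assumes "C > 0" "t\<^sub>2 \<ge> 0" "t\<^sub>3 \<ge> 0" "t\<^sub>2 > 0 \<or> t\<^sub>3 > 1" "c > 1"
  shows "filterlim (\<lambda>s. log_exponent C t\<^sub>2 t\<^sub>3 s - log_exponent C t\<^sub>2 t\<^sub>3 (c * s)) at_top (at_right 0)"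
proof (cases "t\<^sub>2 > 0")
  case True
  define d where "d = C * (1 - (1 / c) powr t\<^sub>2)"
  have "(1 / c) powr t\<^sub>2 < 1"
    using True \<open>c > 1\<close> powr_less_mono2[of t\<^sub>2 "1 / c" 1] by simp
  then have "d > 0" using \<open>C > 0\<close> by (simp add: d_def)
  have "filterlim (\<lambda>s::real. (1 / s) powr t\<^sub>2) at_top (at_right 0)"
    by (rule filterlim_compose[OF filterlim_powr_at_top[OF True]])
       (simp add: divide_inverse filterlim_inverse_at_top_right)
  then have "filterlim (\<lambda>s. d * (1 / s) powr t\<^sub>2) at_top (at_right 0)"
    by (rule filterlim_tendsto_pos_mult_at_top[OF tendsto_const \<open>d > 0\<close>])
  then show ?thesis
  proof (rule filterlim_at_top_mono)
    \<comment> \<open>The term \<open>ln c\<close> keeps \<open>ln (1 / (c * s))\<close> positive,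
      where \<open>powr\<close> is monotone in its base; the 1 makes
      \<open>ln (1 / s) powr t\<^sub>3\<close> at least 1.\<close>
    have "\<forall>\<^sub>F s in at_right 0. ln (1 / s) > ln c + 1"
      using filterlim_ln_inverse_at_right_0 by (auto simp: filterlim_at_top_dense)
    moreover have "\<forall>\<^sub>F s in at_right 0. (s::real) > 0"
      by (rule eventually_at_right_less)
    ultimately show "\<forall>\<^sub>F s in at_right 0. d * (1 / s) powr t\<^sub>2
        \<le> log_exponent C t\<^sub>2 t\<^sub>3 s - log_exponent C t\<^sub>2 t\<^sub>3 (c * s)"
    proof eventually_elim
      case (elim s)
      have lc: "ln c > 0" using \<open>c > 1\<close> by simp
      have ln: "ln (1 / (c * s)) = ln (1 / s) - ln c"
        using elim \<open>c > 1\<close> by (simp add: ln_div ln_mult)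
      have pw: "(1 / (c * s)) powr t\<^sub>2 = (1 / c) powr t\<^sub>2 * (1 / s) powr t\<^sub>2"
        using elim \<open>c > 1\<close> by (simp flip: powr_mult)
      have "log_exponent C t\<^sub>2 t\<^sub>3 (c * s) \<le> C * ((1 / c) powr t\<^sub>2 * (1 / s) powr t\<^sub>2) * ln (1 / s) powr t\<^sub>3"
        unfolding log_exponent_def ln pw using elim lc \<open>C > 0\<close> \<open>t\<^sub>3 \<ge> 0\<close>
        by (intro mult_left_mono powr_mono2) auto
      then have "log_exponent C t\<^sub>2 t\<^sub>3 s - log_exponent C t\<^sub>2 t\<^sub>3 (c * s) \<ge> d * (1 / s) powr t\<^sub>2 * ln (1 / s) powr t\<^sub>3"
        by (simp add: log_exponent_def d_def algebra_simps)
      moreover have "d * (1 / s) powr t\<^sub>2 * 1 \<le> d * (1 / s) powr t\<^sub>2 * ln (1 / s) powr t\<^sub>3"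
        using elim lc \<open>d > 0\<close> \<open>t\<^sub>3 \<ge> 0\<close> by (intro mult_left_mono ge_one_powr_ge_zero) auto
      ultimately show ?case by simp
    qed
  qed
next
  case False
  then have [simp]: "t\<^sub>2 = 0" and t3: "t\<^sub>3 > 1" using assms by auto
  have lc: "ln c > 0" using \<open>c > 1\<close> by simp
  have "filterlim (\<lambda>s::real. ln (1 / s) powr (t\<^sub>3 - 1)) at_top (at_right 0)"
    by (rule filterlim_compose[OF filterlim_powr_at_top filterlim_ln_inverse_at_right_0]) (use t3 in simp)
  then have "filterlim (\<lambda>s. C * ln c * ln (1 / s) powr (t\<^sub>3 - 1)) at_top (at_right 0)"
    using lc \<open>C > 0\<close> by (intro filterlim_tendsto_pos_mult_at_top[OF tendsto_const]) auto
  then show ?thesis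
  proof (rule filterlim_at_top_mono)
    have "\<forall>\<^sub>F s in at_right 0. ln (1 / s) > ln c"
      using filterlim_ln_inverse_at_right_0 by (auto simp: filterlim_at_top_dense)
    moreover have "\<forall>\<^sub>F s in at_right 0. (s::real) > 0"
      by (rule eventually_at_right_less)
    ultimately show "\<forall>\<^sub>F s in at_right 0. C * ln c * ln (1 / s) powr (t\<^sub>3 - 1)
        \<le> log_exponent C t\<^sub>2 t\<^sub>3 s - log_exponent C t\<^sub>2 t\<^sub>3 (c * s)"
    proof eventually_elim
      case (elim s)
      have ln: "ln (1 / (c * s)) = ln (1 / s) - ln c"
        using elim \<open>c > 1\<close> by (simp add: ln_div ln_mult)
      have "C * (ln c * ln (1 / s) powr (t\<^sub>3 - 1)) \<le> C * (ln (1 / s) powr t\<^sub>3 - (ln (1 / s) - ln c) powr t\<^sub>3)"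
        using elim lc t3 \<open>C > 0\<close> by (intro mult_left_mono powr_diff_ge) auto
      then show ?case using elim \<open>c > 1\<close>
        by (simp add: log_exponent_def ln right_diff_distrib mult.assoc)
    qed
  qed
qed

lemma is_arg_min_le:
  fixes f :: "'a \<Rightarrow> 'b::linorder"
  shows "is_arg_min f P x \<Longrightarrow> P y \<Longrightarrow> f x \<le> f y"
  by (auto simp: is_arg_min_def not_less)

text \<open>Testing minimality against a fixed \<open>s\<close> gives \<open>h \<longlongrightarrow> 0\<close>. Testing it against \<open>c * h\<close> avoids
  differentiating the objective: the variance part \<open>v\<close> satisfies \<open>v (c * h) \<le> v h / 2\<close> for small
  \<open>h\<close>, so minimality forces \<open>v h / 2 \<le> a * (c powr (2 * \<beta>) - 1) * h powr (2 * \<beta>)\<close>, and \<open>c > 1\<close> is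
  arbitrary.\<close>
lemma
  fixes h :: "nat \<Rightarrow> real"
  assumes pos: "a > 0" "b > 0" "\<beta> > 0" "C\<^sub>1 > 0" "C\<^sub>2 > 0"
    and t: "t\<^sub>1 \<ge> 0" "t\<^sub>2 \<ge> 0" "t\<^sub>3 \<ge> 0" "t\<^sub>2 > 0 \<or> t\<^sub>3 > 1"
    and h: "\<And>n. h n > 0"
    and argmin: "\<forall>\<^sub>F n in sequentially.
      is_arg_min (bandwidth_objective a b \<beta> C\<^sub>1 C\<^sub>2 t\<^sub>1 t\<^sub>2 t\<^sub>3 n) (\<lambda>s. 0 < s \<and> s < 1) (h n)"
  shows arg_min_bandwidth_tendsto_0: "h \<longlonglongrightarrow> 0"
    and arg_min_bandwidth_variance_negligible:
      "filterlim (\<lambda>n. real n * (C\<^sub>1 * h n powr t\<^sub>1 * exp (- log_exponent C\<^sub>2 t\<^sub>2 t\<^sub>3 (h n))) * h n powr (2 * \<beta>))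
        at_top sequentially"
proof -
  \<comment> \<open>The variance part with its factor \<open>1 / n\<close> removed, hence the same
    function for all \<open>n\<close>.\<close>
  define V where "V = (\<lambda>s. b / C\<^sub>1 * (1 / s) powr t\<^sub>1 * exp (log_exponent C\<^sub>2 t\<^sub>2 t\<^sub>3 s))"
  have Vpos: "V s > 0" if "s > 0" for s
    using that pos by (simp add: V_def)
  have obj: "bandwidth_objective a b \<beta> C\<^sub>1 C\<^sub>2 t\<^sub>1 t\<^sub>2 t\<^sub>3 n s = a * s powr (2 * \<beta>) + V s / real n" for n s
    by (simp add: bandwidth_objective_def V_def field_simps)
  have min: "\<forall>\<^sub>F n in sequentially. \<forall>s. 0 < s \<and> s < 1 \<longrightarrow>
      a * h n powr (2 * \<beta>) + V (h n) / real n \<le> a * s powr (2 * \<beta>) + V s / real n"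
    using argmin by eventually_elim (auto dest: is_arg_min_le simp: obj)
  \<comment> \<open>The objective controls this power directly. A fixed competitor \<open>s\<close>
    first makes the bias part small, and then large \<open>n\<close> makes \<open>V s / n\<close>
    small.\<close>
  have hp: "(\<lambda>n. h n powr (2 * \<beta>)) \<longlonglongrightarrow> 0"
  proof (rule tendstoI)
    fix e :: real assume "e > 0"
    have "((\<lambda>s. a * s powr (2 * \<beta>)) \<longlongrightarrow> a * 0) (at_right 0)"
      using pos by (intro tendsto_mult tendsto_const tendsto_zero_powrI[where b="2 * \<beta>"] tendsto_ident_at)
        (auto simp: eventually_at_filter)
    then have "\<forall>\<^sub>F s in at_right 0. a * s powr (2 * \<beta>) < a * e / 2"
      using \<open>e > 0\<close> pos by (intro order_tendstoD(2)) auto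
    moreover have "\<forall>\<^sub>F s in at_right 0. 0 < s \<and> s < (1::real)"
      using eventually_at_right_less[of "0::real"] eventually_at_right_field[of "\<lambda>s. s < 1" "0::real"]
      by (auto simp: eventually_conj_iff intro!: exI[of _ 1])
    ultimately have "\<forall>\<^sub>F s in at_right 0. a * s powr (2 * \<beta>) < a * e / 2 \<and> 0 < s \<and> s < 1"
      by eventually_elim auto
    then obtain s where s: "a * s powr (2 * \<beta>) < a * e / 2" "0 < s" "s < 1"
      using eventually_happens'[OF trivial_limit_at_right_real] by blast
    have "(\<lambda>n. V s / real n) \<longlonglongrightarrow> 0" by (rule lim_const_over_n)
    then have "\<forall>\<^sub>F n in sequentially. V s / real n < a * e / 2"
      using \<open>e > 0\<close> pos by (intro order_tendstoD(2)) auto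
    with min show "\<forall>\<^sub>F n in sequentially. dist (h n powr (2 * \<beta>)) 0 < e"
    proof eventually_elim
      case (elim n)
      have "V (h n) / real n \<ge> 0" using Vpos[OF h] by (simp add: less_imp_le)
      moreover have "a * h n powr (2 * \<beta>) + V (h n) / real n \<le> a * s powr (2 * \<beta>) + V s / real n"
        using elim(1) s(2,3) by blast
      ultimately have "a * h n powr (2 * \<beta>) < a * e" using elim(2) s(1) by linarith
      then show ?case using pos by simp
    qed
  qed
  have "(\<lambda>n. (h n powr (2 * \<beta>)) powr (1 / (2 * \<beta>))) \<longlonglongrightarrow> 0"
    by (rule tendsto_zero_powrI[OF hp tendsto_const]) (use pos in auto)
  then show h0: "h \<longlonglongrightarrow> 0"
    using pos h by (simp add: powr_powr less_imp_le)
  then have h0r: "filterlim h (at_right 0) sequentially"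
    using h by (intro tendsto_imp_filterlim_at_right) auto
  have doubling: "\<forall>\<^sub>F s in at_right 0. V (c * s) \<le> V s / 2" if "c > 1" for c
  proof -
    \<comment> \<open>A gap of \<open>ln 2\<close> in the exponent halves the exponential; the
      factor \<open>(1 / s) powr t\<^sub>1\<close> only decreases when \<open>s\<close>
      grows.\<close>
    have "\<forall>\<^sub>F s in at_right 0. log_exponent C\<^sub>2 t\<^sub>2 t\<^sub>3 s - log_exponent C\<^sub>2 t\<^sub>2 t\<^sub>3 (c * s) \<ge> ln 2"
      using log_exponent_gap_at_top[OF pos(5) t(2-4) that] by (auto simp: filterlim_at_top)
    moreover have "\<forall>\<^sub>F s in at_right 0. (s::real) > 0"
      by (rule eventually_at_right_less)
    ultimately show ?thesis
    proof eventually_elim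
      case (elim s)
      have "exp (log_exponent C\<^sub>2 t\<^sub>2 t\<^sub>3 (c * s)) \<le> exp (log_exponent C\<^sub>2 t\<^sub>2 t\<^sub>3 s - ln 2)"
        using elim by simp
      also have "\<dots> = exp (log_exponent C\<^sub>2 t\<^sub>2 t\<^sub>3 s) / 2" by (simp add: exp_diff)
      finally have e: "exp (log_exponent C\<^sub>2 t\<^sub>2 t\<^sub>3 (c * s)) \<le> exp (log_exponent C\<^sub>2 t\<^sub>2 t\<^sub>3 s) / 2" .
      have "1 / (c * s) \<le> 1 / s" using elim that by (intro divide_left_mono) auto
      then have "(1 / (c * s)) powr t\<^sub>1 \<le> (1 / s) powr t\<^sub>1"
        using elim that t by (intro powr_mono2) auto
      then have "b / C\<^sub>1 * (1 / (c * s)) powr t\<^sub>1 * exp (log_exponent C\<^sub>2 t\<^sub>2 t\<^sub>3 (c * s))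
          \<le> b / C\<^sub>1 * (1 / s) powr t\<^sub>1 * (exp (log_exponent C\<^sub>2 t\<^sub>2 t\<^sub>3 s) / 2)"
        using pos e by (intro mult_mono mult_left_mono) auto
      then show ?case by (simp add: V_def)
    qed
  qed
  show "filterlim (\<lambda>n. real n * (C\<^sub>1 * h n powr t\<^sub>1 * exp (- log_exponent C\<^sub>2 t\<^sub>2 t\<^sub>3 (h n))) * h n powr (2 * \<beta>))
        at_top sequentially"
    unfolding filterlim_at_top
  proof
    fix Z :: real
    \<comment> \<open>With \<open>c powr (2 * \<beta>) = 1 + \<epsilon>\<close>, comparing
      \<open>h n\<close> with \<open>c * h n\<close> yields \<open>V (h n) / n \<le> 2 * a *
      \<epsilon> * h n powr (2 * \<beta>)\<close>. The choice of \<epsilon> makes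
      \<open>2 * a * \<epsilon>\<close> equal to \<open>b / (\<bar>Z\<bar> + 1)\<close>; the added 1
      avoids division by zero.\<close>
    define \<epsilon> where "\<epsilon> = b / (2 * a * (\<bar>Z\<bar> + 1))"
    have \<epsilon>: "\<epsilon> > 0" using pos by (auto simp: \<epsilon>_def)
    define c where "c = (1 + \<epsilon>) powr (1 / (2 * \<beta>))"
    have c1: "c > 1" unfolding c_def using \<epsilon> pos by (intro gr_one_powr) auto
    have c: "c powr (2 * \<beta>) = 1 + \<epsilon>" using \<epsilon> pos by (simp add: c_def powr_powr)
    have "\<forall>\<^sub>F n in sequentially. V (c * h n) \<le> V (h n) / 2"
      using filterlim_iff[THEN iffD1, OF h0r, rule_format, OF doubling[OF c1]] .
    \<comment> \<open>Keeps the competitor \<open>c * h n\<close> inside the interval over which the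
      objective is minimized.\<close>
    moreover have "\<forall>\<^sub>F n in sequentially. h n < 1 / c"
      using h0 c1 by (intro order_tendstoD(2)) auto
    moreover have "\<forall>\<^sub>F n in sequentially. n > 0"
      by (rule eventually_gt_at_top)
    ultimately show "\<forall>\<^sub>F n in sequentially.
      Z \<le> real n * (C\<^sub>1 * h n powr t\<^sub>1 * exp (- log_exponent C\<^sub>2 t\<^sub>2 t\<^sub>3 (h n))) * h n powr (2 * \<beta>)"
      using min
    proof eventually_elim
      case (elim n)
      have "c * h n < 1" using elim c1 by (simp add: field_simps)
      then have "a * h n powr (2 * \<beta>) + V (h n) / real n \<le> a * (c * h n) powr (2 * \<beta>) + V (c * h n) / real n"
        using elim c1 h[of n] by auto
      also have "(c * h n) powr (2 * \<beta>) = (1 + \<epsilon>) * h n powr (2 * \<beta>)"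
        using c1 h[of n] by (simp add: powr_mult c)
      also have "V (c * h n) / real n \<le> V (h n) / 2 / real n"
        using elim by (intro divide_right_mono) auto
      finally have "V (h n) / real n \<le> 2 * a * \<epsilon> * h n powr (2 * \<beta>)"
        by (simp add: field_simps)
      then have V: "V (h n) \<le> real n * h n powr (2 * \<beta>) * (2 * a * \<epsilon>)"
        using elim by (simp add: field_simps)
      have "2 * a * \<epsilon> = b / (\<bar>Z\<bar> + 1)" using pos by (simp add: \<epsilon>_def)
      with V have "(\<bar>Z\<bar> + 1) * V (h n) \<le> real n * h n powr (2 * \<beta>) * b"
        by (simp add: pos_le_divide_eq mult.commute)
      then have "\<bar>Z\<bar> + 1 \<le> real n * h n powr (2 * \<beta>) * (b / V (h n))"
        using Vpos[OF h, of n] by (simp add: pos_le_divide_eq)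
      also have "b / V (h n) = C\<^sub>1 * h n powr t\<^sub>1 * exp (- log_exponent C\<^sub>2 t\<^sub>2 t\<^sub>3 (h n))"
        using pos h[of n] by (simp add: V_def powr_divide exp_minus field_simps)
      finally show ?case by (simp add: mult_ac)
    qed
  qed
qed

subsection \<open>Numerators of the bias and the variance term\<close>

lemma regular_cond_dist_measurable:
  assumes "regular_cond_dist M R X Y \<kappa>"
  shows "\<kappa> \<in> borel \<rightarrow>\<^sub>M subprob_algebra R" "sets (\<kappa> z) = sets R" "prob_space (\<kappa> z)"
proof -
  have \<kappa>: "\<kappa> \<in> borel \<rightarrow>\<^sub>M prob_algebra R"
    using assms by (simp add: regular_cond_dist_def)
  then show "\<kappa> \<in> borel \<rightarrow>\<^sub>M subprob_algebra R" by (rule measurable_prob_algebraD)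
  show "sets (\<kappa> z) = sets R" "prob_space (\<kappa> z)"
    using measurable_space[OF \<kappa>, of z] by (simp_all add: space_prob_algebra)
qed

lemma square_integrable_if_nn_integral_le:
  fixes f :: "'a \<Rightarrow> 'b::{banach, second_countable_topology}"
  assumes "f \<in> borel_measurable M" "(\<integral>\<^sup>+u. ennreal ((norm (f u))\<^sup>2) \<partial>M) \<le> ennreal C" "0 \<le> C"
  shows "integrable M (\<lambda>u. (norm (f u))\<^sup>2)" "(\<integral>u. (norm (f u))\<^sup>2 \<partial>M) \<le> C"
proof -
  show i: "integrable M (\<lambda>u. (norm (f u))\<^sup>2)"
    using assms by (intro integrableI_bounded) (auto intro: le_less_trans)
  show "(\<integral>u. (norm (f u))\<^sup>2 \<partial>M) \<le> C"
    using assms(2,3) nn_integral_eq_integral[OF i] by simp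
qed

text \<open>On a fibre of \<open>X\<close> the weight is constant and \<open>G y\<close> is centred
  at its conditional mean, so the fibre integral vanishes. The weight lives on \<open>A\<close>: the
  conditional moment bound is used only there, and the second moment gains the factor
  \<open>P (X \<in> A)\<close>, which becomes the small ball probability.\<close>

lemma weighted_residual_moments:
  fixes X :: "'w \<Rightarrow> 'c::polish_space" and G :: "'r \<Rightarrow> 'g::{banach, second_countable_topology}"
    and L :: "'g \<Rightarrow> 'b::{banach, second_countable_topology}"
  assumes "prob_space M" and XY: "(\<lambda>\<omega>. (X \<omega>, Y \<omega>)) \<in> M \<rightarrow>\<^sub>M borel \<Otimes>\<^sub>M R"
    and rcd: "regular_cond_dist M R X Y \<kappa>"
    and w[measurable]: "w \<in> borel_measurable borel"
    and A[measurable]: "A \<in> sets borel"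
    and w_bound: "\<And>z. 0 \<le> w z \<and> w z \<le> u * indicator A z" "0 \<le> u"
    and G[measurable]: "G \<in> borel_measurable R"
    and L: "bounded_linear L" and B: "\<And>v. norm (L v) \<le> norm v * B" "0 \<le> B"
    and moment: "\<And>z. z \<in> A \<Longrightarrow>
      (\<integral>\<^sup>+y. ennreal (norm (G y - integral\<^sup>L (\<kappa> z) G) powr \<nu>) \<partial>\<kappa> z) \<le> ennreal c"
    and "2 \<le> \<nu>" "0 \<le> c"
  defines "f \<equiv> \<lambda>(z, y). w z *\<^sub>R L (G y - integral\<^sup>L (\<kappa> z) G)"
    and "D \<equiv> distr M (borel \<Otimes>\<^sub>M R) (\<lambda>\<omega>. (X \<omega>, Y \<omega>))"
  shows "f \<in> borel_measurable (borel \<Otimes>\<^sub>M R)"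
    and "integrable D (\<lambda>u. (norm (f u))\<^sup>2)"
    and "integral\<^sup>L D f = 0"
    and "(\<integral>p. (norm (f p))\<^sup>2 \<partial>D) \<le> (u * B)\<^sup>2 * (1 + c) * measure M {\<omega> \<in> space M. X \<omega> \<in> A}"
proof -
  interpret prob_space M by fact
  note XY[measurable]
  have X[measurable]: "X \<in> borel_measurable M"
    using measurable_compose[OF XY measurable_fst] by simp
  note \<kappa>[measurable] = regular_cond_dist_measurable(1)[OF rcd]
  note sets\<kappa>[measurable_cong] = regular_cond_dist_measurable(2)[OF rcd]
  have [measurable]: "L \<in> borel_measurable borel"
    using L by (intro borel_measurable_continuous_onI linear_continuous_on)
  have [measurable]: "(\<lambda>z. integral\<^sup>L (\<kappa> z) G) \<in> borel_measurable borel"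
    by (rule measurable_compose[OF \<kappa> integral_measurable_subprob_algebra]) (rule G)
  show f[measurable]: "f \<in> borel_measurable (borel \<Otimes>\<^sub>M R)"
    unfolding f_def by measurable
  define k where "k = (\<lambda>\<omega>. distr (\<kappa> (X \<omega>)) (borel \<Otimes>\<^sub>M R) (Pair (X \<omega>)))"
  have Dk: "D = M \<bind> k" and k: "k \<in> M \<rightarrow>\<^sub>M subprob_algebra (borel \<Otimes>\<^sub>M R)"
    unfolding D_def k_def using distr_pair_eq_bind[OF assms(1) XY rcd] measurable_cond_pair[OF assms(1) XY rcd] by auto
  have setsD[measurable_cong]: "sets D = sets (borel \<Otimes>\<^sub>M R)" by (simp add: D_def)
  interpret D: prob_space D unfolding D_def by (rule prob_space_distr[OF XY])

  have moment2: "(\<integral>\<^sup>+y. ennreal ((norm (G y - integral\<^sup>L (\<kappa> z) G))\<^sup>2) \<partial>\<kappa> z) \<le> ennreal (1 + c)"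
    if "z \<in> A" for z
  proof -
    interpret \<kappa>: prob_space "\<kappa> z" by (rule regular_cond_dist_measurable(3)[OF rcd])
    \<comment> \<open>Trades the moment of order \<nu> for a second moment; the summand 1 covers
      values below 1.\<close>
    have pw: "v\<^sup>2 \<le> 1 + v powr \<nu>" if "0 \<le> v" for v :: real
    proof (cases "v \<le> 1")
      case True
      then have "v\<^sup>2 \<le> 1" using that by (simp add: power_le_one)
      then show ?thesis by (simp add: add_increasing2)
    next
      case False
      then have "v powr 2 \<le> v powr \<nu>" using \<open>2 \<le> \<nu>\<close> by (intro powr_mono) auto
      then show ?thesis using False by simp
    qed
    have "(\<integral>\<^sup>+y. ennreal ((norm (G y - integral\<^sup>L (\<kappa> z) G))\<^sup>2) \<partial>\<kappa> z)
        \<le> (\<integral>\<^sup>+y. 1 + ennreal (norm (G y - integral\<^sup>L (\<kappa> z) G) powr \<nu>) \<partial>\<kappa> z)"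
      using pw by (intro nn_integral_mono) (simp flip: ennreal_plus ennreal_1 add: ennreal_leI)
    also have "\<dots> = 1 + (\<integral>\<^sup>+y. ennreal (norm (G y - integral\<^sup>L (\<kappa> z) G) powr \<nu>) \<partial>\<kappa> z)"
      by (subst nn_integral_add) (auto simp: \<kappa>.emeasure_space_1)
    also have "\<dots> \<le> 1 + ennreal c" by (intro add_left_mono moment that)
    finally show ?thesis using \<open>0 \<le> c\<close> by (simp add: ennreal_plus)
  qed

  define C where "C = (u * B)\<^sup>2 * (1 + c)"
  have C: "0 \<le> C" using \<open>0 \<le> c\<close> by (simp add: C_def)
  have inner: "(\<integral>\<^sup>+p. ennreal ((norm (f p))\<^sup>2) \<partial>k \<omega>) \<le> ennreal C * indicator {\<omega> \<in> space M. X \<omega> \<in> A} \<omega>"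
    if "\<omega> \<in> space M" for \<omega>
  proof (cases "X \<omega> \<in> A")
    case True
    have "(\<integral>\<^sup>+p. ennreal ((norm (f p))\<^sup>2) \<partial>k \<omega>) = (\<integral>\<^sup>+y. ennreal ((norm (f (X \<omega>, y)))\<^sup>2) \<partial>\<kappa> (X \<omega>))"
      unfolding k_def by (subst nn_integral_distr) auto
    also have "\<dots> \<le> (\<integral>\<^sup>+y. ennreal ((u * B)\<^sup>2) * ennreal ((norm (G y - integral\<^sup>L (\<kappa> (X \<omega>)) G))\<^sup>2) \<partial>\<kappa> (X \<omega>))"
    proof (intro nn_integral_mono)
      fix y
      let ?v = "G y - integral\<^sup>L (\<kappa> (X \<omega>)) G"
      have "norm (f (X \<omega>, y)) \<le> u * (norm ?v * B)"
        unfolding f_def using w_bound(1)[of "X \<omega>"] True B \<open>0 \<le> u\<close> by (auto intro!: mult_mono)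
      then have "(norm (f (X \<omega>, y)))\<^sup>2 \<le> (u * (norm ?v * B))\<^sup>2"
        by (intro power_mono) auto
      then show "ennreal ((norm (f (X \<omega>, y)))\<^sup>2) \<le> ennreal ((u * B)\<^sup>2) * ennreal ((norm ?v)\<^sup>2)"
        by (simp add: power_mult_distrib mult_ac ennreal_leI flip: ennreal_mult)
    qed
    also have "\<dots> = ennreal ((u * B)\<^sup>2) * (\<integral>\<^sup>+y. ennreal ((norm (G y - integral\<^sup>L (\<kappa> (X \<omega>)) G))\<^sup>2) \<partial>\<kappa> (X \<omega>))"
      by (rule nn_integral_cmult) measurable
    also have "\<dots> \<le> ennreal ((u * B)\<^sup>2) * ennreal (1 + c)"
      by (intro mult_left_mono moment2 True) auto
    also have "\<dots> = ennreal C" using \<open>0 \<le> c\<close> by (simp add: C_def ennreal_mult)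
    finally show ?thesis using True that by simp
  next
    case False
    then have "w (X \<omega>) = 0" using w_bound(1)[of "X \<omega>"] by simp
    then have "(\<integral>\<^sup>+p. ennreal ((norm (f p))\<^sup>2) \<partial>k \<omega>) = 0"
      unfolding k_def by (subst nn_integral_distr) (auto simp: f_def)
    then show ?thesis by simp
  qed
  have "(\<integral>\<^sup>+p. ennreal ((norm (f p))\<^sup>2) \<partial>D) = (\<integral>\<^sup>+\<omega>. (\<integral>\<^sup>+p. ennreal ((norm (f p))\<^sup>2) \<partial>k \<omega>) \<partial>M)"
    unfolding Dk by (rule nn_integral_bind[OF _ k]) measurable
  also have "\<dots> \<le> (\<integral>\<^sup>+\<omega>. ennreal C * indicator {\<omega> \<in> space M. X \<omega> \<in> A} \<omega> \<partial>M)"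
    by (intro nn_integral_mono inner)
  also have "\<dots> = ennreal C * emeasure M {\<omega> \<in> space M. X \<omega> \<in> A}"
    by (rule nn_integral_cmult_indicator) measurable
  also have "\<dots> = ennreal (C * measure M {\<omega> \<in> space M. X \<omega> \<in> A})"
    using C by (simp add: emeasure_eq_measure ennreal_mult)
  finally have le: "(\<integral>\<^sup>+p. ennreal ((norm (f p))\<^sup>2) \<partial>D) \<le> ennreal (C * measure M {\<omega> \<in> space M. X \<omega> \<in> A})" .
  have fD: "f \<in> borel_measurable D" by measurable
  have nn: "0 \<le> C * measure M {\<omega> \<in> space M. X \<omega> \<in> A}" using C by simp
  show sq: "integrable D (\<lambda>p. (norm (f p))\<^sup>2)"
    and "(\<integral>p. (norm (f p))\<^sup>2 \<partial>D) \<le> (u * B)\<^sup>2 * (1 + c) * measure M {\<omega> \<in> space M. X \<omega> \<in> A}"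
    using square_integrable_if_nn_integral_le[OF fD le nn] by (simp_all add: C_def)

  have "integral\<^sup>L D f = (\<integral>\<omega>. integral\<^sup>L (k \<omega>) f \<partial>M)"
    unfolding Dk using D.integral_norm_diff_expectation_le(1)[OF fD sq]
    by (intro integral_bind_integrable[OF not_empty k]) (simp add: Dk)
  also have "\<dots> = (\<integral>\<omega>. 0 \<partial>M)"
  proof (intro Bochner_Integration.integral_cong refl)
    fix \<omega> assume "\<omega> \<in> space M"
    interpret \<kappa>: prob_space "\<kappa> (X \<omega>)" by (rule regular_cond_dist_measurable(3)[OF rcd])
    let ?m = "integral\<^sup>L (\<kappa> (X \<omega>)) G"
    have "integral\<^sup>L (k \<omega>) f = (\<integral>y. f (X \<omega>, y) \<partial>\<kappa> (X \<omega>))"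
      unfolding k_def by (rule integral_distr) auto
    also have "\<dots> = (\<integral>y. w (X \<omega>) *\<^sub>R L (G y - ?m) \<partial>\<kappa> (X \<omega>))"
      by (simp add: f_def)
    also have "\<dots> = 0"
    proof (cases "X \<omega> \<in> A")
      case True
      \<comment> \<open>A priori \<open>?m\<close> could be the default value 0 of an undefined
        integral. The moment bound makes \<open>G y - ?m\<close> integrable whatever the constant
        \<open>?m\<close> is, hence \<open>G\<close> is integrable and \<open>?m\<close> is its true
        mean.\<close>
      have meas: "(\<lambda>y. G y - ?m) \<in> borel_measurable (\<kappa> (X \<omega>))" by measurable
      have "0 \<le> 1 + c" using \<open>0 \<le> c\<close> by simp
      then have int: "integrable (\<kappa> (X \<omega>)) (\<lambda>y. G y - ?m)"
        by (rule \<kappa>.integral_norm_diff_expectation_le(1)[OF meas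
            square_integrable_if_nn_integral_le(1)[OF meas moment2[OF True]]])
      have "integrable (\<kappa> (X \<omega>)) (\<lambda>y. (G y - ?m) + ?m)"
        by (rule Bochner_Integration.integrable_add[OF int]) simp
      then have "integrable (\<kappa> (X \<omega>)) G" by simp
      then have "(\<integral>y. G y - ?m \<partial>\<kappa> (X \<omega>)) = 0" by (simp add: \<kappa>.prob_space)
      then have "(\<integral>y. L (G y - ?m) \<partial>\<kappa> (X \<omega>)) = 0"
        using L by (subst integral_bounded_linear[OF L int]) (simp add: linear_simps(3))
      then show ?thesis by simp
    next
      case False
      then have "w (X \<omega>) = 0" using w_bound(1)[of "X \<omega>"] by simp
      then show ?thesis by simp
    qed
    finally show "integral\<^sup>L (k \<omega>) f = 0" .
  qed
  finally show "integral\<^sup>L D f = 0" by simp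
qed

text \<open>The pointwise bound \<open>q\<close> on \<open>A\<close> controls the summand by a
  multiple of an indicator, which settles the second moment. The last conclusion moves the
  normalisation by the mean weight out of the integral and through \<open>L\<close>, so that a lower
  bound on \<open>mean_bias\<close> becomes one on the mean of the unnormalised summand.\<close>

lemma weighted_bias_moments:
  fixes X :: "'w \<Rightarrow> 'c::polish_space" and F :: "'c \<Rightarrow> 'g::{banach, second_countable_topology}"
    and L :: "'g \<Rightarrow> 'b::{banach, second_countable_topology}"
  assumes "prob_space M" and X[measurable]: "X \<in> borel_measurable M"
    and w[measurable]: "w \<in> borel_measurable borel"
    and A[measurable]: "A \<in> sets borel"
    and w_bound: "\<And>z. 0 \<le> w z \<and> w z \<le> u * indicator A z" "0 \<le> u"
    and F[measurable]: "F \<in> borel_measurable borel"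
    and L: "bounded_linear L" and B: "\<And>v. norm (L v) \<le> norm v * B" "0 \<le> B"
    and osc: "\<And>z. z \<in> A \<Longrightarrow> norm (F z - v) \<le> q" and "0 \<le> q"
  defines "f \<equiv> \<lambda>z. w z *\<^sub>R L (F z - v)"
  shows "f \<in> borel_measurable borel"
    and "integrable M (\<lambda>\<omega>. (norm (f (X \<omega>)))\<^sup>2)"
    and "(\<integral>\<omega>. (norm (f (X \<omega>)))\<^sup>2 \<partial>M) \<le> (u * B * q)\<^sup>2 * measure M {\<omega> \<in> space M. X \<omega> \<in> A}"
    and "(\<integral>\<omega>. w (X \<omega>) \<partial>M) \<noteq> 0 \<Longrightarrow>
      (\<integral>\<omega>. f (X \<omega>) \<partial>M) = (\<integral>\<omega>. w (X \<omega>) \<partial>M) *\<^sub>R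
        L (\<integral>\<omega>. (w (X \<omega>) / (\<integral>\<omega>'. w (X \<omega>') \<partial>M)) *\<^sub>R (F (X \<omega>) - v) \<partial>M)"
proof -
  interpret prob_space M by fact
  have [measurable]: "L \<in> borel_measurable borel"
    using L by (intro borel_measurable_continuous_onI linear_continuous_on)
  show f[measurable]: "f \<in> borel_measurable borel"
    unfolding f_def by measurable
  have wz: "w z = 0" if "z \<notin> A" for z using w_bound(1)[of z] that by simp
  have wu: "w z \<le> u" if "z \<in> A" for z using w_bound(1)[of z] that by simp
  have fb: "norm (f z) \<le> u * B * q * indicator A z" for z
  proof (cases "z \<in> A")
    case True
    have "norm (L (F z - v)) \<le> q * B"
      using B osc[OF True] by (meson mult_right_mono order_trans)
    then have "w z * norm (L (F z - v)) \<le> u * (q * B)"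
      using wu[OF True] w_bound by (intro mult_mono) auto
    then show ?thesis using True w_bound(1)[of z] by (simp add: f_def mult_ac)
  qed (simp add: f_def wz)
  have "(\<integral>\<^sup>+\<omega>. ennreal ((norm (f (X \<omega>)))\<^sup>2) \<partial>M)
      \<le> (\<integral>\<^sup>+\<omega>. ennreal ((u * B * q)\<^sup>2) * indicator {\<omega> \<in> space M. X \<omega> \<in> A} \<omega> \<partial>M)"
  proof (intro nn_integral_mono)
    fix \<omega> assume "\<omega> \<in> space M"
    have "(norm (f (X \<omega>)))\<^sup>2 \<le> (u * B * q * indicator A (X \<omega>))\<^sup>2"
      by (intro power_mono fb) auto
    with \<open>\<omega> \<in> space M\<close> show "ennreal ((norm (f (X \<omega>)))\<^sup>2)
        \<le> ennreal ((u * B * q)\<^sup>2) * indicator {\<omega> \<in> space M. X \<omega> \<in> A} \<omega>"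
      by (auto simp: indicator_def ennreal_leI split: if_splits)
  qed
  also have "\<dots> = ennreal ((u * B * q)\<^sup>2) * emeasure M {\<omega> \<in> space M. X \<omega> \<in> A}"
    by (rule nn_integral_cmult_indicator) measurable
  also have "\<dots> = ennreal ((u * B * q)\<^sup>2 * measure M {\<omega> \<in> space M. X \<omega> \<in> A})"
    by (simp add: emeasure_eq_measure ennreal_mult)
  finally have le: "(\<integral>\<^sup>+\<omega>. ennreal ((norm (f (X \<omega>)))\<^sup>2) \<partial>M)
    \<le> ennreal ((u * B * q)\<^sup>2 * measure M {\<omega> \<in> space M. X \<omega> \<in> A})" .
  have meas: "(\<lambda>\<omega>. f (X \<omega>)) \<in> borel_measurable M" by measurable
  show "integrable M (\<lambda>\<omega>. (norm (f (X \<omega>)))\<^sup>2)"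
    and "(\<integral>\<omega>. (norm (f (X \<omega>)))\<^sup>2 \<partial>M) \<le> (u * B * q)\<^sup>2 * measure M {\<omega> \<in> space M. X \<omega> \<in> A}"
    using square_integrable_if_nn_integral_le[OF meas le] by simp_all
  assume nz: "(\<integral>\<omega>. w (X \<omega>) \<partial>M) \<noteq> 0"
  let ?W = "\<integral>\<omega>. w (X \<omega>) \<partial>M"
  have "norm (w z *\<^sub>R (F z - v)) \<le> u * q" for z
  proof (cases "z \<in> A")
    case True
    then have "w z * norm (F z - v) \<le> u * q"
      using wu w_bound osc by (intro mult_mono) auto
    then show ?thesis using w_bound(1)[of z] by simp
  qed (use wz w_bound \<open>0 \<le> q\<close> in auto)
  then have int: "integrable M (\<lambda>\<omega>. w (X \<omega>) *\<^sub>R (F (X \<omega>) - v))"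
    by (intro integrable_const_bound[where B="u * q"]) auto
  have "(\<integral>\<omega>. (w (X \<omega>) / ?W) *\<^sub>R (F (X \<omega>) - v) \<partial>M) = (\<integral>\<omega>. (1 / ?W) *\<^sub>R (w (X \<omega>) *\<^sub>R (F (X \<omega>) - v)) \<partial>M)"
    by simp
  also have "\<dots> = (1 / ?W) *\<^sub>R (\<integral>\<omega>. w (X \<omega>) *\<^sub>R (F (X \<omega>) - v) \<partial>M)"
    by (rule integral_scaleR_right)
  finally have "?W *\<^sub>R L (\<integral>\<omega>. (w (X \<omega>) / ?W) *\<^sub>R (F (X \<omega>) - v) \<partial>M) = L (\<integral>\<omega>. w (X \<omega>) *\<^sub>R (F (X \<omega>) - v) \<partial>M)"
    using nz by (simp add: linear_simps(5)[OF L])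
  also have "\<dots> = (\<integral>\<omega>. f (X \<omega>) \<partial>M)"
    unfolding f_def by (subst integral_bounded_linear[OF L int, symmetric]) (simp add: linear_simps(5)[OF L])
  finally show "(\<integral>\<omega>. f (X \<omega>) \<partial>M) = ?W *\<^sub>R L (\<integral>\<omega>. (w (X \<omega>) / ?W) *\<^sub>R (F (X \<omega>) - v) \<partial>M)"
    by (rule sym)
qed

text \<open>Valid for a vanishing denominator too: division by zero gives 0 on both sides.\<close>

lemma variance_term_eq:
  assumes "bounded_linear L"
  shows "variance_term L G \<kappa> K x Xs Ys n h \<omega> =
    (1 / (\<Sum>i=1..n. K (dist x (Xs i \<omega>) / h))) *\<^sub>R
      (\<Sum>i=1..n. K (dist x (Xs i \<omega>) / h) *\<^sub>R L (G (Ys i \<omega>) - integral\<^sup>L (\<kappa> (Xs i \<omega>)) G))"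
proof -
  interpret bounded_linear L by fact
  show ?thesis
    by (simp add: variance_term_def kernel_weight_def sum scaleR scaleR_sum_right)
qed

text \<open>Here the denominator must not vanish: \<open>F x\<close> can be moved under the sum only
  because the weights add up to 1. With all weights 0 the bias term would be
  \<open>L (- F x)\<close>.\<close>

lemma bias_term_eq:
  assumes "bounded_linear L" and "(\<Sum>i=1..n. K (dist x (Xs i \<omega>) / h)) \<noteq> 0"
  shows "bias_term L F K x Xs n h \<omega> =
    (1 / (\<Sum>i=1..n. K (dist x (Xs i \<omega>) / h))) *\<^sub>R
      (\<Sum>i=1..n. K (dist x (Xs i \<omega>) / h) *\<^sub>R L (F (Xs i \<omega>) - F x))"
proof -
  interpret bounded_linear L by fact
  let ?S = "\<Sum>i=1..n. K (dist x (Xs i \<omega>) / h)"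
  have "(\<Sum>i=1..n. kernel_weight K x Xs n h \<omega> i) = 1"
    unfolding kernel_weight_def sum_divide_distrib[symmetric] using assms(2) by simp
  then have "F x = (\<Sum>i=1..n. kernel_weight K x Xs n h \<omega> i *\<^sub>R F x)"
    by (simp flip: scaleR_sum_left)
  then have "bias_term L F K x Xs n h \<omega> = L (\<Sum>i=1..n. kernel_weight K x Xs n h \<omega> i *\<^sub>R (F (Xs i \<omega>) - F x))"
    unfolding bias_term_def by (simp add: scaleR_diff_right sum_subtractf)
  also have "\<dots> = (1 / ?S) *\<^sub>R (\<Sum>i=1..n. K (dist x (Xs i \<omega>) / h) *\<^sub>R L (F (Xs i \<omega>) - F x))"
    by (simp add: kernel_weight_def sum scaleR scaleR_sum_right)
  finally show ?thesis .
qed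

text \<open>Bias and variance term have the same denominator, so no concentration of it is needed; it
  is nonzero as soon as the numerator of the bias is.\<close>
lemma variance_bias_ratio_le:
  fixes L :: "'g::{banach, second_countable_topology} \<Rightarrow> 'b::real_normed_vector"
  assumes L: "bounded_linear L" and K: "\<And>u. u \<ge> 0 \<Longrightarrow> K u \<ge> (0::real)" and "h > 0" "\<epsilon> > 0" "q > 0"
    and V: "norm (\<Sum>i=1..n. K (dist x (Xs i \<omega>) / h) *\<^sub>R L (G (Ys i \<omega>) - integral\<^sup>L (\<kappa> (Xs i \<omega>)) G)) \<le> \<epsilon> * q"
    and S: "q \<le> norm (\<Sum>i=1..n. K (dist x (Xs i \<omega>) / h) *\<^sub>R L (F (Xs i \<omega>) - F x))"
  shows "ennreal (norm (variance_term L G \<kappa> K x Xs Ys n h \<omega>))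
    / ennreal (norm (bias_term L F K x Xs n h \<omega>)) \<le> ennreal \<epsilon>"
proof -
  let ?W = "\<Sum>i=1..n. K (dist x (Xs i \<omega>) / h)"
  let ?V = "\<Sum>i=1..n. K (dist x (Xs i \<omega>) / h) *\<^sub>R L (G (Ys i \<omega>) - integral\<^sup>L (\<kappa> (Xs i \<omega>)) G)"
  let ?S = "\<Sum>i=1..n. K (dist x (Xs i \<omega>) / h) *\<^sub>R L (F (Xs i \<omega>) - F x)"
  have nn: "K (dist x (Xs i \<omega>) / h) \<ge> 0" for i using \<open>h > 0\<close> by (intro K) simp
  \<comment> \<open>A vanishing sum of nonnegative weights forces every weight to vanish, and with
    them the numerator \<open>?S\<close>, which is at least \<open>q > 0\<close> in norm.\<close>
  have "?W \<noteq> 0"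
  proof
    assume "?W = 0"
    then have "\<forall>i\<in>{1..n}. K (dist x (Xs i \<omega>) / h) = 0"
      using nn by (subst (asm) sum_nonneg_eq_0_iff) auto
    then have "?S = 0" by simp
    with S \<open>q > 0\<close> show False by simp
  qed
  moreover have "?W \<ge> 0" by (intro sum_nonneg nn)
  ultimately have W: "?W > 0" by simp
  have S0: "norm ?S > 0" using S \<open>q > 0\<close> by linarith
  have "norm ?V \<le> \<epsilon> * norm ?S"
    using V S \<open>\<epsilon> > 0\<close> by (meson mult_left_mono less_imp_le order_trans)
  then have "norm ?V / ?W / (norm ?S / ?W) \<le> \<epsilon>"
    using W S0 by (simp add: pos_divide_le_eq)
  then show ?thesis
    unfolding variance_term_eq[OF L] bias_term_eq[where K=K and x=x and Xs=Xs and \<omega>=\<omega> and n=n and h=h, OF L \<open>?W \<noteq> 0\<close>]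
    using W S0 by (simp add: divide_ennreal ennreal_leI)
qed

section \<open>Tail bounds for both numerators at the optimum bandwidth, and their
  combination\<close>

theorem theorem8:
  fixes M :: "'w measure"
    and R :: "'r measure"
    and X :: "'w \<Rightarrow> 'c::polish_space" and Y :: "'w \<Rightarrow> 'r"
    and Xs :: "nat \<Rightarrow> 'w \<Rightarrow> 'c" and Ys :: "nat \<Rightarrow> 'w \<Rightarrow> 'r"
    and \<kappa> :: "'c \<Rightarrow> 'r measure"
    and x :: 'c
    and K :: "real \<Rightarrow> real"
    and F :: "'c \<Rightarrow> 'g::{banach, second_countable_topology}"
    and G :: "'r \<Rightarrow> 'g"
    and L :: "'g \<Rightarrow> 'b::{banach, second_countable_topology}"
    and T :: "'r measure \<Rightarrow> 'b"
    and C\<^sub>1 C\<^sub>2 C\<^sub>3 C\<^sub>4 t\<^sub>1 t\<^sub>2 t\<^sub>3 t\<^sub>4 lK uK \<beta> b\<^sub>F \<nu> b\<^sub>1 a b :: real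
    and h :: "nat \<Rightarrow> real"
  assumes "prob_space M"
    and "(\<lambda>\<omega>. (X \<omega>, Y \<omega>)) \<in> M \<rightarrow>\<^sub>M borel \<Otimes>\<^sub>M R"
    and "prob_space.indep_vars M (\<lambda>_. borel \<Otimes>\<^sub>M R) (\<lambda>i \<omega>. (Xs i \<omega>, Ys i \<omega>)) {1..}"
    and "\<And>i. i \<ge> 1 \<Longrightarrow> distr M (borel \<Otimes>\<^sub>M R) (\<lambda>\<omega>. (Xs i \<omega>, Ys i \<omega>))
                        = distr M (borel \<Otimes>\<^sub>M R) (\<lambda>\<omega>. (X \<omega>, Y \<omega>))"
    and "regular_cond_dist M R X Y \<kappa>"
    and "K \<in> borel_measurable (restrict_space borel {0..})"
    and "\<And>u. u \<ge> 0 \<Longrightarrow> K u \<ge> 0"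
    and "type_two TYPE('b)"
    and "has_schauder_basis TYPE('b)"
    and "F \<in> borel_measurable borel"
    and "G \<in> borel_measurable R"
    and "bounded_linear L"
    and "C\<^sub>1 > 0" "C\<^sub>2 > 0" "C\<^sub>3 > 0" "C\<^sub>4 > 0"
    and "t\<^sub>1 \<ge> 0" "t\<^sub>2 \<ge> 0" "t\<^sub>3 \<ge> 0" "t\<^sub>4 \<ge> 0"
    and "\<forall>\<^sub>F s in at_right 0.
           C\<^sub>1 * s powr t\<^sub>1 * exp (- log_exponent C\<^sub>2 t\<^sub>2 t\<^sub>3 s) \<le> small_ball M X x s \<and>
           small_ball M X x s \<le> C\<^sub>3 * s powr t\<^sub>4 * exp (- log_exponent C\<^sub>4 t\<^sub>2 t\<^sub>3 s)"
    and "t\<^sub>2 > 0 \<or> (t\<^sub>3 > 1 \<and> C\<^sub>2 = C\<^sub>4)"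
    and "0 < lK" "lK \<le> uK"
    and "\<And>u. 0 \<le> u \<Longrightarrow> u \<le> 1 \<Longrightarrow> lK \<le> K u \<and> K u \<le> uK"
    and "\<And>u. u > 1 \<Longrightarrow> K u = 0"
    and "\<beta> > 0" "b\<^sub>F > 0"
    and "\<forall>\<^sub>F z in nhds x. norm (F z - F x) \<le> b\<^sub>F * dist x z powr \<beta>"
    and "\<nu> > 2"
    and "\<exists>c::real. \<forall>\<^sub>F z in nhds x.
           (\<integral>\<^sup>+y. ennreal (norm (G y - integral\<^sup>L (\<kappa> z) G) powr \<nu>) \<partial>\<kappa> z) \<le> ennreal c"
    and "\<And>k. bandwidth_seq M X x k \<Longrightarrow>
           small_o_prob M
             (\<lambda>n \<omega>. ennreal (norm (T (weighted_empirical R K x Xs Ys n (k n) \<omega>) - T (\<kappa> x)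
                - bias_term L F K x Xs n (k n) \<omega> - variance_term L G \<kappa> K x Xs Ys n (k n) \<omega>)))
             (\<lambda>n. max (k n powr \<beta>) ((real n * small_ball M X x (k n)) powr (- 1 / 2)))"
    and "b\<^sub>1 > 0"
    and "\<And>k. bandwidth_seq M X x k \<Longrightarrow>
           \<forall>\<^sub>F n in sequentially. k n powr (- \<beta>) * norm (mean_bias M X L F K x (k n)) > b\<^sub>1"
    and "a > 0" "b > 0"
    and "\<And>k. bandwidth_seq M X x k \<Longrightarrow>
           \<forall>\<^sub>F n in sequentially.
             (\<integral>\<^sup>+\<omega>. ennreal ((norm (bias_term L F K x Xs n (k n) \<omega>
                + variance_term L G \<kappa> K x Xs Ys n (k n) \<omega>))\<^sup>2) \<partial>M)
             \<le> ennreal (bandwidth_objective a b \<beta> C\<^sub>1 C\<^sub>2 t\<^sub>1 t\<^sub>2 t\<^sub>3 n (k n))"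
    and "\<And>n. h n > 0"
    and "\<forall>\<^sub>F n in sequentially.
           is_arg_min (bandwidth_objective a b \<beta> C\<^sub>1 C\<^sub>2 t\<^sub>1 t\<^sub>2 t\<^sub>3 n) (\<lambda>s. 0 < s \<and> s < 1) (h n)"
  shows "small_o_prob M
           (\<lambda>n \<omega>. ennreal (norm (variance_term L G \<kappa> K x Xs Ys n (h n) \<omega>))
                  / ennreal (norm (bias_term L F K x Xs n (h n) \<omega>)))
           (\<lambda>_. 1)"
proof -
  note indep = assms(3) and iid = assms(4) and rcd = assms(5) and K_meas = assms(6) and K_nonneg = assms(7)
    and F_meas[measurable] = assms(10) and G_meas[measurable] = assms(11) and L_lin = assms(12)
    and C_pos = assms(13-16) and t_nonneg = assms(17-20) and small_ball_bounds = assms(21)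
    and super_poly = assms(22) and l_pos = assms(23) and l_le_u = assms(24)
    and K_bounds = assms(25) and K_zero = assms(26) and \<beta>_pos = assms(27) and bF_pos = assms(28)
    and holder = assms(29) and \<nu> = assms(30) and moment = assms(31) and b1_pos = assms(33)
    and mean_bias_lower = assms(34) and a_pos = assms(35) and b_pos = assms(36)
    and h_pos = assms(38) and argmin = assms(39)
  interpret prob_space M by (rule assms(1))
  note XY[measurable] = assms(2)
  have X[measurable]: "X \<in> borel_measurable M"
    using measurable_compose[OF XY measurable_fst] by simp
  note \<kappa>[measurable] = regular_cond_dist_measurable(1)[OF rcd]
  have L_meas[measurable]: "L \<in> borel_measurable borel"
    using L_lin by (intro borel_measurable_continuous_onI linear_continuous_on)
  have G_mean_meas[measurable]: "(\<lambda>z. integral\<^sup>L (\<kappa> z) G) \<in> borel_measurable borel"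
    by (rule measurable_compose[OF \<kappa> integral_measurable_subprob_algebra]) (rule G_meas)
  define w where "w = (\<lambda>n z. K (dist x z / h n))"
  have w_meas[measurable]: "w n \<in> borel_measurable borel" for n
  proof -
    \<comment> \<open>\<open>K\<close> is assumed measurable on \<open>{0..}\<close>, so the
      composition passes through \<open>restrict_space\<close>.\<close>
    have "(\<lambda>z. dist x z / h n) \<in> borel \<rightarrow>\<^sub>M restrict_space borel {0..}"
      using h_pos[of n] by (intro measurable_restrict_space2) auto
    from measurable_compose[OF this K_meas] show ?thesis by (simp add: w_def)
  qed
  have XYs: "(\<lambda>\<omega>. (Xs i \<omega>, Ys i \<omega>)) \<in> M \<rightarrow>\<^sub>M borel \<Otimes>\<^sub>M R" if "i \<ge> 1" for i
    using indep that by (auto simp: indep_vars_def)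
  have Xs[measurable]: "Xs i \<in> borel_measurable M" and Ys[measurable]: "Ys i \<in> M \<rightarrow>\<^sub>M R"
    if "i \<ge> 1" for i
    using that measurable_compose[OF XYs[of i] measurable_fst] measurable_compose[OF XYs[of i] measurable_snd]
    by simp_all
  have residual_meas[measurable]: "(\<lambda>\<omega>. G (Ys i \<omega>) - integral\<^sup>L (\<kappa> (Xs i \<omega>)) G) \<in> borel_measurable M"
    if "i \<ge> 1" for i
    by (rule borel_measurable_diff[OF measurable_compose[OF Ys[OF that] G_meas]
        measurable_compose[OF Xs[OF that] G_mean_meas]])
  define \<phi> where "\<phi> = (\<lambda>n. small_ball M X x (h n))"
  define A where "A = (\<lambda>n. cball x (h n))"
  have A_meas[measurable]: "A n \<in> sets borel" for n by (simp add: A_def)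
  have \<phi>_eq: "\<phi> n = measure M {\<omega> \<in> space M. X \<omega> \<in> A n}" for n
    by (simp add: \<phi>_def small_ball_def A_def)
  have w_bounds: "0 \<le> w n z \<and> w n z \<le> uK * indicator (A n) z" "lK * indicator (A n) z \<le> w n z" for n z
    using K_nonneg[of "dist x z / h n"] K_bounds[of "dist x z / h n"] K_zero[of "dist x z / h n"] h_pos[of n]
    by (auto simp: w_def A_def indicator_def)
  have u_pos: "0 < uK" using l_pos l_le_u by simp

  \<comment> \<open>The assumed lower bound for \<open>\<phi> n\<close>. Up to the factor
    \<open>b / n\<close> it is the reciprocal of the variance part of the objective, so growth
    obtained from minimality carries over to \<phi>.\<close>
  define \<psi> where "\<psi> = (\<lambda>n. C\<^sub>1 * h n powr t\<^sub>1 * exp (- log_exponent C\<^sub>2 t\<^sub>2 t\<^sub>3 (h n)))"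
  have t: "t\<^sub>2 > 0 \<or> t\<^sub>3 > 1" using super_poly by auto
  have h0: "h \<longlonglongrightarrow> 0"
    by (rule arg_min_bandwidth_tendsto_0[OF a_pos b_pos \<beta>_pos C_pos(1,2) t_nonneg(1-3) t h_pos argmin])
  then have h0r: "filterlim h (at_right 0) sequentially"
    using h_pos by (intro tendsto_imp_filterlim_at_right) auto
  have \<psi>: "\<forall>\<^sub>F n in sequentially. \<psi> n \<le> \<phi> n"
    using filterlim_iff[THEN iffD1, OF h0r, rule_format, OF small_ball_bounds]
    by eventually_elim (simp add: \<psi>_def \<phi>_def)
  have "filterlim (\<lambda>n. real n * \<psi> n * h n powr (2 * \<beta>)) at_top sequentially"
    unfolding \<psi>_def
    by (rule arg_min_bandwidth_variance_negligible[OF a_pos b_pos \<beta>_pos C_pos(1,2) t_nonneg(1-3) t h_pos argmin])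
  moreover have "\<forall>\<^sub>F n in sequentially. real n * \<psi> n * h n powr (2 * \<beta>) \<le> real n * \<phi> n * h n powr (2 * \<beta>)"
    using \<psi> by eventually_elim (intro mult_right_mono mult_left_mono, auto)
  ultimately have signal: "filterlim (\<lambda>n. real n * \<phi> n * h n powr (2 * \<beta>)) at_top sequentially"
    by (rule filterlim_at_top_mono)
  have h_lt_1: "\<forall>\<^sub>F n in sequentially. h n < 1"
    using h0 by (intro order_tendstoD(2)) auto
  \<comment> \<open>Since \<open>h n < 1\<close> eventually, the divergence just shown is stronger
    than that of \<open>n * \<phi>\<close>. Thus \<open>h\<close> is a bandwidth sequence, and the
    lower bound on the mean bias applies to it.\<close>
  have "\<forall>\<^sub>F n in sequentially. real n * \<phi> n * h n powr (2 * \<beta>) \<le> real n * \<phi> n"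
    using h_lt_1
  proof eventually_elim
    case (elim n)
    have "h n powr (2 * \<beta>) \<le> 1" using elim h_pos[of n] \<beta>_pos by (intro powr_le1) auto
    then show ?case by (intro mult_left_le) (auto simp: \<phi>_eq)
  qed
  with signal have n\<phi>: "filterlim (\<lambda>n. real n * \<phi> n) at_top sequentially"
    by (rule filterlim_at_top_mono)
  have bw: "bandwidth_seq M X x h"
    using h_pos h0 n\<phi> by (simp add: bandwidth_seq_def \<phi>_def)

  obtain B where B: "\<And>v. norm (L v) \<le> norm v * B" "0 \<le> B"
    using bounded_linear.nonneg_bounded[OF L_lin] by blast
  obtain c' where c': "\<forall>\<^sub>F z in nhds x.
      (\<integral>\<^sup>+y. ennreal (norm (G y - integral\<^sup>L (\<kappa> z) G) powr \<nu>) \<partial>\<kappa> z) \<le> ennreal c'"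
    using moment by blast
  \<comment> \<open>A negative \<open>c'\<close> is sent to 0 by \<open>ennreal\<close>, so the
    maximum preserves the bound.\<close>
  define c where "c = max c' 0"
  have c0: "0 \<le> c" by (simp add: c_def)
  have "\<forall>\<^sub>F z in nhds x. norm (F z - F x) \<le> b\<^sub>F * dist x z powr \<beta> \<and>
      (\<integral>\<^sup>+y. ennreal (norm (G y - integral\<^sup>L (\<kappa> z) G) powr \<nu>) \<partial>\<kappa> z) \<le> ennreal c"
    using holder c'
    by eventually_elim (auto simp: c_def intro: order_trans[OF _ ennreal_leI])
  \<comment> \<open>One radius for both local assumptions; once \<open>h n < d\<close>, the support
    \<open>A n\<close> of the weight lies inside.\<close>
  then obtain d where "d > 0" and d: "\<And>z. dist z x < d \<Longrightarrow> norm (F z - F x) \<le> b\<^sub>F * dist x z powr \<beta>"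
      "\<And>z. dist z x < d \<Longrightarrow>
        (\<integral>\<^sup>+y. ennreal (norm (G y - integral\<^sup>L (\<kappa> z) G) powr \<nu>) \<partial>\<kappa> z) \<le> ennreal c"
    unfolding eventually_nhds_metric by blast
  have h_lt_d: "\<forall>\<^sub>F n in sequentially. h n < d"
    using h0 \<open>d > 0\<close> by (intro order_tendstoD(2)) auto

  have oscillation: "norm (F z - F x) \<le> b\<^sub>F * h n powr \<beta>" if "z \<in> A n" "h n < d" for z n
  proof -
    have "norm (F z - F x) \<le> b\<^sub>F * dist x z powr \<beta>"
      using that by (intro d(1)) (simp add: A_def dist_commute)
    also have "\<dots> \<le> b\<^sub>F * h n powr \<beta>"
      using that \<beta>_pos bF_pos by (intro mult_left_mono powr_mono2) (auto simp: A_def)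
    finally show ?thesis .
  qed

  define D where "D = distr M (borel \<Otimes>\<^sub>M R) (\<lambda>\<omega>. (X \<omega>, Y \<omega>))"
  obtain ct where "ct > 0" and tail_M: "\<And>(M :: 'w measure) (N :: ('c \<times> 'r) measure) D U (f :: 'c \<times> 'r \<Rightarrow> 'b) n t.
      prob_space M \<Longrightarrow> prob_space.indep_vars M (\<lambda>_. N) U {1..} \<Longrightarrow>
      (\<And>i. i \<ge> 1 \<Longrightarrow> distr M N (U i) = D) \<Longrightarrow> f \<in> borel_measurable N \<Longrightarrow>
      integrable D (\<lambda>u. (norm (f u))\<^sup>2) \<Longrightarrow> t > 0 \<Longrightarrow>
      measure M {\<omega> \<in> space M. t \<le> norm ((\<Sum>i=1..n. f (U i \<omega>)) - real n *\<^sub>R integral\<^sup>L D f)}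
        \<le> ct * (real n * (\<integral>u. (norm (f u))\<^sup>2 \<partial>D)) / t\<^sup>2"
    using type_two_iid_tail[where 'w='w and 'a="'c \<times> 'r", OF assms(8)] by blast
  note tail = tail_M[OF prob_space_axioms]

  define SV where "SV = (\<lambda>n \<omega>. \<Sum>i=1..n. w n (Xs i \<omega>) *\<^sub>R L (G (Ys i \<omega>) - integral\<^sup>L (\<kappa> (Xs i \<omega>)) G))"
  define SB where "SB = (\<lambda>n \<omega>. \<Sum>i=1..n. w n (Xs i \<omega>) *\<^sub>R L (F (Xs i \<omega>) - F x))"
  define \<mu> where "\<mu> = (\<lambda>n. real n *\<^sub>R (\<integral>\<omega>. w n (X \<omega>) *\<^sub>R L (F (X \<omega>) - F x) \<partial>M))"
  \<comment> \<open>Half the lower bound for \<open>norm (\<mu> n)\<close>: the mean weight is at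
    least \<open>lK * \<phi> n\<close> and the mean bias at least
    \<open>b\<^sub>1 * h n powr \<beta>\<close>. The other half is left for the fluctuation of
    \<open>SB\<close>.\<close>
  define q where "q = (\<lambda>n. real n * lK * \<phi> n * b\<^sub>1 * h n powr \<beta> / 2)"

  have SV_meas[measurable]: "SV n \<in> borel_measurable M" for n
    unfolding SV_def by measurable
  have SB_meas[measurable]: "SB n \<in> borel_measurable M" for n
    unfolding SB_def by measurable

  have q_pos: "\<forall>\<^sub>F n in sequentially. q n > 0"
  proof -
    have "\<forall>\<^sub>F n in sequentially. real n * \<phi> n > 0"
      using n\<phi> by (simp add: filterlim_at_top_dense)
    then show ?thesis
    proof eventually_elim
      case (elim n)
      then have "(real n * \<phi> n) * (lK * b\<^sub>1 * h n powr \<beta> / 2) > 0"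
        by (rule mult_pos_pos) (use l_pos b1_pos h_pos[of n] in simp)
      then show ?case by (simp add: q_def mult_ac)
    qed
  qed

  have mean_lower: "\<forall>\<^sub>F n in sequentially. 2 * q n \<le> norm (\<mu> n)"
    using mean_bias_lower[OF bw] q_pos h_lt_d
  proof eventually_elim
    case (elim n)
    have "0 \<le> \<phi> n" by (simp add: \<phi>_eq)
    moreover have "\<phi> n \<noteq> 0" using elim(2) by (auto simp: q_def)
    ultimately have \<phi>_pos: "0 < \<phi> n" by simp
    have "norm (w n z) \<le> uK" for z
      using w_bounds(1)[of n z] u_pos by (cases "z \<in> A n") auto
    then have wint: "integrable M (\<lambda>\<omega>. w n (X \<omega>))"
      by (intro integrable_const_bound[where B=uK] AE_I2) auto
    have "lK * \<phi> n = (\<integral>\<omega>. lK * indicator {\<omega> \<in> space M. X \<omega> \<in> A n} \<omega> \<partial>M)"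
      by (simp add: \<phi>_eq)
    also have "\<dots> \<le> (\<integral>\<omega>. w n (X \<omega>) \<partial>M)"
    proof (rule integral_mono[OF _ wint])
      show "lK * indicator {\<omega> \<in> space M. X \<omega> \<in> A n} \<omega> \<le> w n (X \<omega>)" if "\<omega> \<in> space M" for \<omega>
        using w_bounds(2)[of n "X \<omega>"] that by (simp add: indicator_def)
    qed (auto intro!: integrable_mult_right integrable_real_indicator simp: less_top[symmetric])
    finally have W: "lK * \<phi> n \<le> (\<integral>\<omega>. w n (X \<omega>) \<partial>M)" .
    have W_pos: "0 < lK * \<phi> n" using l_pos \<phi>_pos by simp
    have "\<mu> n = real n *\<^sub>R ((\<integral>\<omega>. w n (X \<omega>) \<partial>M) *\<^sub>R mean_bias M X L F K x (h n))"
    proof -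
      from weighted_bias_moments(4)[OF assms(1) X w_meas A_meas w_bounds(1) _ F_meas L_lin B oscillation[OF _ elim(3)]]
      show ?thesis using u_pos bF_pos W W_pos unfolding \<mu>_def mean_bias_def w_def by simp
    qed
    then have "norm (\<mu> n) = real n * ((\<integral>\<omega>. w n (X \<omega>) \<partial>M) * norm (mean_bias M X L F K x (h n)))"
      using W W_pos by simp
    moreover have "b\<^sub>1 * h n powr \<beta> \<le> norm (mean_bias M X L F K x (h n))"
      using elim(1) h_pos[of n] by (simp add: powr_minus field_simps)
    then have "real n * ((lK * \<phi> n) * (b\<^sub>1 * h n powr \<beta>))
        \<le> real n * ((\<integral>\<omega>. w n (X \<omega>) \<partial>M) * norm (mean_bias M X L F K x (h n)))"
      using W W_pos b1_pos by (intro mult_left_mono mult_mono) auto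
    ultimately show ?case by (simp add: q_def mult_ac)
  qed

  \<comment> \<open>In both constants the denominator is what remains of
    \<open>(q n)\<^sup>2\<close> after removing \<open>n\<close>, \<open>\<phi> n\<close> and the
    power of \<open>h n\<close>. That power cancels for the bias, whose summands are of order
    \<open>h n powr \<beta>\<close>, but not for the variance; hence the two different rates
    below.\<close>
  define cB where "cB = ct * (uK * B * b\<^sub>F)\<^sup>2 / (lK * b\<^sub>1 / 2)\<^sup>2"
  define cV where "cV = ct * ((uK * B)\<^sup>2 * (1 + c)) / (lK * b\<^sub>1 / 2)\<^sup>2"

  have tail_bias: "\<forall>\<^sub>F n in sequentially.
      measure M {\<omega> \<in> space M. q n \<le> norm (SB n \<omega> - \<mu> n)} \<le> cB * inverse (real n * \<phi> n)"
    using q_pos h_lt_d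
  proof eventually_elim
    case (elim n)
    then have "q n \<noteq> 0" by simp
    then have nz: "real n \<noteq> 0" "\<phi> n \<noteq> 0" "lK \<noteq> 0" "b\<^sub>1 \<noteq> 0" by (simp_all add: q_def)
    let ?f = "\<lambda>z. w n z *\<^sub>R L (F z - F x)"
    note osc = oscillation[OF _ elim(2)]
    note W = weighted_bias_moments[OF assms(1) X w_meas A_meas w_bounds(1) _ F_meas L_lin B osc]
    have f[measurable]: "?f \<in> borel_measurable borel"
      by measurable
    \<comment> \<open>The bias summand is read as a function of the pair through \<open>fst\<close>,
      since independence and equality in law are given for pairs.\<close>
    have "integrable D (\<lambda>p. (norm (?f (fst p)))\<^sup>2)" "(\<integral>p. ?f (fst p) \<partial>D) = (\<integral>\<omega>. ?f (X \<omega>) \<partial>M)"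
      "(\<integral>p. (norm (?f (fst p)))\<^sup>2 \<partial>D) \<le> (uK * B * (b\<^sub>F * h n powr \<beta>))\<^sup>2 * \<phi> n"
      using W(2,3) u_pos bF_pos unfolding D_def \<phi>_eq by (simp_all add: integrable_distr_eq integral_distr)
    note fD = this
    have "measure M {\<omega> \<in> space M. q n \<le> norm (SB n \<omega> - \<mu> n)}
        \<le> ct * (real n * (\<integral>p. (norm (?f (fst p)))\<^sup>2 \<partial>D)) / (q n)\<^sup>2"
      using tail[OF indep, of D "\<lambda>p. ?f (fst p)" "q n" n] iid elim(1) fD(1,2)
      unfolding SB_def \<mu>_def by (simp add: D_def[symmetric])
    also have "\<dots> \<le> ct * (real n * ((uK * B * (b\<^sub>F * h n powr \<beta>))\<^sup>2 * \<phi> n)) / (q n)\<^sup>2"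
      using \<open>ct > 0\<close> by (intro divide_right_mono mult_left_mono fD(3)) auto
    also have "\<dots> = cB * inverse (real n * \<phi> n)"
      using nz h_pos[of n] by (simp add: cB_def q_def power_mult_distrib field_simps power2_eq_square)
    finally show ?case .
  qed

  have tail_var: "\<forall>\<^sub>F n in sequentially. measure M {\<omega> \<in> space M. \<epsilon> * q n \<le> norm (SV n \<omega>)}
      \<le> cV / \<epsilon>\<^sup>2 * inverse (real n * \<phi> n * h n powr (2 * \<beta>))" if "\<epsilon> > 0" for \<epsilon>
    using q_pos h_lt_d
  proof eventually_elim
    case (elim n)
    then have "q n \<noteq> 0" by simp
    then have nz: "real n \<noteq> 0" "\<phi> n \<noteq> 0" "lK \<noteq> 0" "b\<^sub>1 \<noteq> 0" by (simp_all add: q_def)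
    let ?f = "\<lambda>(z, y). w n z *\<^sub>R L (G y - integral\<^sup>L (\<kappa> z) G)"
    have mom: "(\<integral>\<^sup>+y. ennreal (norm (G y - integral\<^sup>L (\<kappa> z) G) powr \<nu>) \<partial>\<kappa> z) \<le> ennreal c"
      if "z \<in> A n" for z
      using that elim(2) by (intro d(2)) (simp add: A_def dist_commute)
    have "0 \<le> uK" "2 \<le> \<nu>" using u_pos \<nu> by auto
    note W = weighted_residual_moments[OF assms(1) XY rcd w_meas A_meas w_bounds(1) this(1) G_meas L_lin B mom this(2) c0,
        folded D_def \<phi>_eq]
    have "measure M {\<omega> \<in> space M. \<epsilon> * q n \<le> norm (SV n \<omega>)}
        \<le> ct * (real n * (\<integral>p. (norm (?f p))\<^sup>2 \<partial>D)) / (\<epsilon> * q n)\<^sup>2"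
      using tail[OF indep, of D ?f "\<epsilon> * q n" n] iid elim(1) that W(1-3)
      unfolding SV_def by (simp add: D_def[symmetric])
    also have "\<dots> \<le> ct * (real n * ((uK * B)\<^sup>2 * (1 + c) * \<phi> n)) / (\<epsilon> * q n)\<^sup>2"
      using \<open>ct > 0\<close> by (intro divide_right_mono mult_left_mono W(4)) auto
    also have "\<dots> = cV / \<epsilon>\<^sup>2 * inverse (real n * \<phi> n * (h n powr \<beta>)\<^sup>2)"
      using nz h_pos[of n] that by (simp add: cV_def q_def power_mult_distrib field_simps power2_eq_square)
    also have "(h n powr \<beta>)\<^sup>2 = h n powr (2 * \<beta>)"
      by (simp add: power2_eq_square flip: powr_add)
    finally show ?case .
  qed

  have K_kernel_meas[measurable]: "(\<lambda>\<omega>. K (dist x (Xs i \<omega>) / h n)) \<in> borel_measurable M" if "i \<ge> 1" for i n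
    using measurable_compose[OF Xs[OF that] w_meas[of n]] by (simp add: w_def)
  have kw_meas[measurable]: "(\<lambda>\<omega>. kernel_weight K x Xs n (h n) \<omega> i) \<in> borel_measurable M" if "i \<ge> 1" for i n
    unfolding kernel_weight_def using that by measurable
  have [measurable]: "variance_term L G \<kappa> K x Xs Ys n (h n) \<in> borel_measurable M"
    "bias_term L F K x Xs n (h n) \<in> borel_measurable M" for n
    unfolding variance_term_def bias_term_def by measurable
  show ?thesis
    unfolding small_o_prob_def
  proof (intro conjI allI impI)
    show "(\<lambda>\<omega>. ennreal (norm (variance_term L G \<kappa> K x Xs Ys n (h n) \<omega>))
        / ennreal (norm (bias_term L F K x Xs n (h n) \<omega>))) \<in> borel_measurable M" for n
      by measurable
    fix \<epsilon> :: real assume "\<epsilon> > 0"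
    let ?E = "\<lambda>n. {\<omega> \<in> space M. ennreal (norm (variance_term L G \<kappa> K x Xs Ys n (h n) \<omega>))
        / ennreal (norm (bias_term L F K x Xs n (h n) \<omega>)) > ennreal (\<epsilon> * 1)}"
    have upper: "\<forall>\<^sub>F n in sequentially. measure M (?E n) \<le>
        cV / \<epsilon>\<^sup>2 * inverse (real n * \<phi> n * h n powr (2 * \<beta>)) + cB * inverse (real n * \<phi> n)"
      using tail_var[OF \<open>\<epsilon> > 0\<close>] tail_bias mean_lower q_pos
    proof eventually_elim
      case (elim n)
      \<comment> \<open>Outside both exceptional events \<open>norm (SB n \<omega>)\<close> is at
        least \<open>2 * q n - q n = q n\<close>, while \<open>norm (SV n \<omega>)\<close> is below
        \<open>\<epsilon> * q n\<close>.\<close>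
      have "?E n \<subseteq> {\<omega> \<in> space M. \<epsilon> * q n \<le> norm (SV n \<omega>)} \<union> {\<omega> \<in> space M. q n \<le> norm (SB n \<omega> - \<mu> n)}"
      proof (rule subsetI, rule ccontr)
        fix \<omega> assume \<omega>: "\<omega> \<in> ?E n" and
          "\<omega> \<notin> {\<omega> \<in> space M. \<epsilon> * q n \<le> norm (SV n \<omega>)} \<union> {\<omega> \<in> space M. q n \<le> norm (SB n \<omega> - \<mu> n)}"
        then have V: "norm (SV n \<omega>) \<le> \<epsilon> * q n" and S: "norm (SB n \<omega> - \<mu> n) < q n" by auto
        have "norm (\<mu> n) - norm (SB n \<omega>) \<le> norm (SB n \<omega> - \<mu> n)"
          by (metis norm_minus_commute norm_triangle_ineq2)
        with S elim(3) have "q n \<le> norm (SB n \<omega>)" by linarith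
        with V have "ennreal (norm (variance_term L G \<kappa> K x Xs Ys n (h n) \<omega>))
            / ennreal (norm (bias_term L F K x Xs n (h n) \<omega>)) \<le> ennreal \<epsilon>"
          unfolding SV_def SB_def w_def
          by (intro variance_bias_ratio_le[OF L_lin K_nonneg h_pos \<open>\<epsilon> > 0\<close> elim(4)])
        with \<omega> show False by auto
      qed
      then have "measure M (?E n) \<le> measure M ({\<omega> \<in> space M. \<epsilon> * q n \<le> norm (SV n \<omega>)} \<union> {\<omega> \<in> space M. q n \<le> norm (SB n \<omega> - \<mu> n)})"
        by (intro finite_measure_mono) measurable
      also have "\<dots> \<le> measure M {\<omega> \<in> space M. \<epsilon> * q n \<le> norm (SV n \<omega>)} + measure M {\<omega> \<in> space M. q n \<le> norm (SB n \<omega> - \<mu> n)}"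
        by (intro measure_subadditive) auto
      finally show ?case using elim(1,2) by linarith
    qed
    have "(\<lambda>n. cV / \<epsilon>\<^sup>2 * inverse (real n * \<phi> n * h n powr (2 * \<beta>)) + cB * inverse (real n * \<phi> n))
        \<longlonglongrightarrow> cV / \<epsilon>\<^sup>2 * 0 + cB * 0"
      by (intro tendsto_intros tendsto_inverse_0_at_top signal n\<phi>)
    then have lim: "(\<lambda>n. cV / \<epsilon>\<^sup>2 * inverse (real n * \<phi> n * h n powr (2 * \<beta>)) + cB * inverse (real n * \<phi> n))
        \<longlonglongrightarrow> 0"
      by simp
    show "(\<lambda>n. measure M (?E n)) \<longlonglongrightarrow> 0"
      by (rule tendsto_sandwich[OF always_eventually upper tendsto_const lim]) simp
  qed
qed

end
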